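(* Let $n\ge 1$ and $q\ge 1$ be integers and let $c\in\mathbb{R}\setminus\{0\}$ be fixed. Let $f=[f_0:\dots:f_n]:\mathbb{R}\to\mathbb{TP}^n$ be a tropical holomorphic curve (with reduced representation $(f_0,\dots,f_n)$) which is tropically linearly nondegenerate. Let $H_1,\dots,H_q$ be arbitrary tropical hyperplanes in $\mathbb{TP}^n$ defined by tropical linear polynomials $P_1,\dots,P_q$ with coefficient vectors $a_1,\dots,a_q$ respectively. If $$\limsup_{r\to\infty}\frac{\log T_f(r)}{r}=0,$$ then there is a set $E\subset[1,\infty)$ of zero upper density measure such that $$\sum_{\sigma=\pm1}\max_K\frac12\sum_{k\in K}\lambda_{H_k}(f(\sigma r))\le (n+1)T_f(r)-N\bigl(r,1_{\mathbb{T}}\oslash C(f)\bigr)+o(T_f(r))$$ as $r\to\infty$, $r\notin E$, where the maximum is taken over all subsets $K\subset\{1,\dots,q\}$ such that the vectors $a_j$, $j\in K$, are tropically linearly independent, and $C(f)$ is the tropical Casorati determinant of $f$ (with shift $c$).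
   Context: Tropical semiring: $\mathbb{T}=\mathbb{R}\cup\{-\infty\}$, $x\oplus y=\max(x,y)$, $x\otimes y=x+y$, $x\oslash y=x-y$, $0_{\mathbb{T}}=-\infty$, $1_{\mathbb{T}}=0$. Tropical projective space $\mathbb{TP}^n$ is $\mathbb{T}^{n+1}\setminus\{(0_{\mathbb{T}},\dots,0_{\mathbb{T}})\}$ modulo $(a_0,\dots,a_n)\sim(\lambda+a_0,\dots,\lambda+a_n)$, $\lambda\in\mathbb{R}$. Hyperplanes: a tropical linear polynomial is $P(x)=\max_{0\le i\le n}(a_i+x_i)$ with coefficient vector $a=(a_0,\dots,a_n)\in\mathbb{T}^{n+1}$ not all $0_{\mathbb{T}}$. The tropical hyperplane it defines is $H=\{x\in\mathbb{TP}^n:\ \max_i(a_i+x_i)\text{ is attained for at least two indices } i\}$ (in particular $x\in H$ if all terms are $-\infty$). Tropical linear dependence: vectors $v_1,\dots,v_m\in\mathbb{T}^{n+1}$, $v_i=(v_{i0},\dots,v_{in})$, are tropically linearly dependent if there are $\alpha_1,\dots,\alpha_m\in\mathbb{T}$, not all $0_{\mathbb{T}}$, such that for every $0\le j\le n$ the maximum $\max_{1\le i\le m}(\alpha_i+v_{ij})$ is attained for at least two indices $i$; otherwise they are tropically linearly independent. Functions: a tropical meromorphic function is a continuous piecewise linear $g:\mathbb{R}\to\mathbb{R}$ (real slopes, finitely many non-differentiability points in each bounded interval). Put $\omega_g(x)=\lim_{\varepsilon\to0^+}(g'(x+\varepsilon)-g'(x-\varepsilon))$; $x$ is a root of multiplicity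 $\omega_g(x)$ if $\omega_g(x)>0$, and a pole of multiplicity $-\omega_g(x)$ if $\omega_g(x)<0$. A tropical entire function is a tropical meromorphic function without poles. The counting function is $N(r,g)=\frac12\int_0^r n(t,g)\,dt$ with $n(t,g)=\sum_{|s|\le t,\ \omega_g(s)<0}|\omega_g(s)|$ (poles); thus $N(r,1_{\mathbb{T}}\oslash g)=N(r,-g)$ counts the roots of $g$. Curves: a tropical holomorphic map (curve) $f=[f_0:\dots:f_n]:\mathbb{R}\to\mathbb{TP}^n$ is given by tropical entire functions $f_0,\dots,f_n$ having no common root (reduced representation). Put $\|f(x)\|=\max_i f_i(x)$, $T_f(r)=\frac12(\|f(r)\|+\|f(-r)\|)-\|f(0)\|$, and $P\circ f=\max_i(a_i+f_i)$. The map $f$ is tropically linearly nondegenerate if $f(\mathbb{R})$ is not contained in any tropical hyperplane of $\mathbb{TP}^n$. Weil function: for $H$ defined by $P$ with coefficient vector $a$ and $\|a\|=\max_i a_i$, $\lambda_H(f(x))=\|f(x)\|+\|a\|-P\circ f(x)$. Casorati determinant: $C(f)(x)=\max_{\pi}\sum_{i=0}^n f_i(x+\pi(i)c)$, the maximum over all permutations $\pi$ of $\{0,\dots,n\}$. A set $E\subset[1,\infty)$ has zero upper density measure if $\limsup_{r\to\infty}\frac1r\int_{E\cap[1,r]}dt=0$. *)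

theory Defs
  imports "HOL-Analysis.Analysis" "HOL-Combinatorics.Permutations" "HOL-Library.Landau_Symbols"
begin

text \<open>
  The tropical semiring is rendered by the elements of \<^typ>\<open>ereal\<close> other than \<^term>\<open>\<infinity>::ereal\<close>, with
  maximum as addition and addition as multiplication.  A vector of length \<open>n + 1\<close> is a function
  on \<^typ>\<open>nat\<close> of which only the values at the indices \<open>0, \<dots>, n\<close> are relevant.
\<close>

definition max_attained_twice :: "nat set \<Rightarrow> (nat \<Rightarrow> ereal) \<Rightarrow> bool" where
  "max_attained_twice I t \<longleftrightarrow>
     (\<exists>i\<in>I. \<exists>j\<in>I. i \<noteq> j \<and> t i = Max (t ` I) \<and> t j = Max (t ` I))"

definition trop_nonzero_vectors :: "nat \<Rightarrow> (nat \<Rightarrow> ereal) set" where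
  "trop_nonzero_vectors n = {x. (\<forall>i\<le>n. x i \<noteq> \<infinity>) \<and> (\<exists>i\<le>n. x i \<noteq> -\<infinity>)}"

definition trop_proj_rel :: "nat \<Rightarrow> ((nat \<Rightarrow> ereal) \<times> (nat \<Rightarrow> ereal)) set" where
  "trop_proj_rel n =
     {(x, y). x \<in> trop_nonzero_vectors n \<and> y \<in> trop_nonzero_vectors n \<and>
              (\<exists>l::real. \<forall>i\<le>n. y i = ereal l + x i)}"

definition trop_proj_space :: "nat \<Rightarrow> (nat \<Rightarrow> ereal) set set" where
  "trop_proj_space n = trop_nonzero_vectors n // trop_proj_rel n"

definition trop_point :: "nat \<Rightarrow> (nat \<Rightarrow> ereal) \<Rightarrow> (nat \<Rightarrow> ereal) set" where
  "trop_point n x = trop_proj_rel n `` {x}"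

definition trop_hyperplane :: "nat \<Rightarrow> (nat \<Rightarrow> ereal) \<Rightarrow> (nat \<Rightarrow> ereal) set set" where
  "trop_hyperplane n a =
     {p \<in> trop_proj_space n. \<exists>x\<in>p. max_attained_twice {..n} (\<lambda>i. a i + x i)}"

text \<open>
  Dependence is a property of the family \<open>v\<close> indexed by the set \<open>K\<close>, not of the set of its values:
  a family with a repeated vector is dependent, and the empty family is independent.
\<close>

definition trop_lin_dependent :: "nat \<Rightarrow> nat set \<Rightarrow> (nat \<Rightarrow> nat \<Rightarrow> ereal) \<Rightarrow> bool" where
  "trop_lin_dependent n K v \<longleftrightarrow>
     (\<exists>\<alpha>. (\<forall>i\<in>K. \<alpha> i \<noteq> \<infinity>) \<and> (\<exists>i\<in>K. \<alpha> i \<noteq> -\<infinity>) \<and>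
          (\<forall>j\<le>n. max_attained_twice K (\<lambda>i. \<alpha> i + v i j)))"

abbreviation trop_lin_independent :: "nat \<Rightarrow> nat set \<Rightarrow> (nat \<Rightarrow> nat \<Rightarrow> ereal) \<Rightarrow> bool" where
  "trop_lin_independent n K v \<equiv> \<not> trop_lin_dependent n K v"

text \<open>
  The last conjunct is piecewise linearity: the function is affine between consecutive
  points of non-differentiability.
\<close>

definition trop_meromorphic :: "(real \<Rightarrow> real) \<Rightarrow> bool" where
  "trop_meromorphic g \<longleftrightarrow>
     continuous_on UNIV g \<and>
     (\<forall>a b. finite {x \<in> {a..b}. \<not> g differentiable (at x)}) \<and>
     (\<forall>a b. (\<forall>x\<in>{a<..<b}. g differentiable (at x)) \<longrightarrow>
            (\<exists>m d. \<forall>x\<in>{a<..<b}. g x = m * x + d))"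

definition trop_omega :: "(real \<Rightarrow> real) \<Rightarrow> real \<Rightarrow> real" where
  "trop_omega g x = Lim (at_right 0) (\<lambda>\<epsilon>. deriv g (x + \<epsilon>) - deriv g (x - \<epsilon>))"

definition trop_root :: "(real \<Rightarrow> real) \<Rightarrow> real \<Rightarrow> bool" where
  "trop_root g x \<longleftrightarrow> trop_omega g x > 0"

definition trop_pole :: "(real \<Rightarrow> real) \<Rightarrow> real \<Rightarrow> bool" where
  "trop_pole g x \<longleftrightarrow> trop_omega g x < 0"

definition trop_entire :: "(real \<Rightarrow> real) \<Rightarrow> bool" where
  "trop_entire g \<longleftrightarrow> trop_meromorphic g \<and> (\<forall>x. \<not> trop_pole g x)"

definition trop_n :: "real \<Rightarrow> (real \<Rightarrow> real) \<Rightarrow> real" where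
  "trop_n t g = (\<Sum>s | \<bar>s\<bar> \<le> t \<and> trop_pole g s. \<bar>trop_omega g s\<bar>)"

definition trop_N :: "real \<Rightarrow> (real \<Rightarrow> real) \<Rightarrow> real" where
  "trop_N r g = 1/2 * integral {0..r} (\<lambda>t. trop_n t g)"

text \<open>
  A curve is given by its reduced representation, the functions \<open>f 0, \<dots>, f n\<close>.
\<close>

definition trop_holomorphic_curve :: "nat \<Rightarrow> (nat \<Rightarrow> real \<Rightarrow> real) \<Rightarrow> bool" where
  "trop_holomorphic_curve n f \<longleftrightarrow>
     (\<forall>i\<le>n. trop_entire (f i)) \<and> \<not> (\<exists>x. \<forall>i\<le>n. trop_root (f i) x)"

definition curve_point :: "nat \<Rightarrow> (nat \<Rightarrow> real \<Rightarrow> real) \<Rightarrow> real \<Rightarrow> (nat \<Rightarrow> ereal) set" where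
  "curve_point n f x = trop_point n (\<lambda>i. ereal (f i x))"

definition trop_lin_nondegenerate :: "nat \<Rightarrow> (nat \<Rightarrow> real \<Rightarrow> real) \<Rightarrow> bool" where
  "trop_lin_nondegenerate n f \<longleftrightarrow>
     \<not> (\<exists>a\<in>trop_nonzero_vectors n. range (curve_point n f) \<subseteq> trop_hyperplane n a)"

definition curve_norm :: "nat \<Rightarrow> (nat \<Rightarrow> real \<Rightarrow> real) \<Rightarrow> real \<Rightarrow> real" where
  "curve_norm n f x = (MAX i\<in>{..n}. f i x)"

definition trop_T :: "nat \<Rightarrow> (nat \<Rightarrow> real \<Rightarrow> real) \<Rightarrow> real \<Rightarrow> real" where
  "trop_T n f r = 1/2 * (curve_norm n f r + curve_norm n f (- r)) - curve_norm n f 0"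

definition coeff_norm :: "nat \<Rightarrow> (nat \<Rightarrow> ereal) \<Rightarrow> ereal" where
  "coeff_norm n a = (MAX i\<in>{..n}. a i)"

definition trop_linear_comp :: "nat \<Rightarrow> (nat \<Rightarrow> ereal) \<Rightarrow> (nat \<Rightarrow> real \<Rightarrow> real) \<Rightarrow> real \<Rightarrow> ereal" where
  "trop_linear_comp n a f x = (MAX i\<in>{..n}. a i + ereal (f i x))"

text \<open>
  The Weil function of the hyperplane with coefficient vector \<open>a\<close>.  For a non-zero vector \<open>a\<close> all
  three terms are finite, and the value does not change when a real constant is added to \<open>a\<close>.
\<close>

definition weil_function :: "nat \<Rightarrow> (nat \<Rightarrow> ereal) \<Rightarrow> (nat \<Rightarrow> real \<Rightarrow> real) \<Rightarrow> real \<Rightarrow> real" where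
  "weil_function n a f x =
     real_of_ereal (ereal (curve_norm n f x) + coeff_norm n a - trop_linear_comp n a f x)"

definition trop_casorati :: "nat \<Rightarrow> real \<Rightarrow> (nat \<Rightarrow> real \<Rightarrow> real) \<Rightarrow> real \<Rightarrow> real" where
  "trop_casorati n c f x =
     (MAX \<pi>\<in>{\<pi>. \<pi> permutes {..n}}. \<Sum>i\<le>n. f i (x + real (\<pi> i) * c))"

definition zero_upper_density :: "real set \<Rightarrow> bool" where
  "zero_upper_density E \<longleftrightarrow>
     E \<subseteq> {1..} \<and> E \<in> sets lebesgue \<and>
     Limsup at_top (\<lambda>r. ereal (1 / r * measure lebesgue (E \<inter> {1..r}))) = 0"

end

theory Submission
  imports Defs
begin

text \<open>
  Write \<open>G = max\<^sub>i f\<^sub>i\<close>.  The inequality is proved at the points \<open>r\<close> and \<open>- r\<close> separately and then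
  averaged, because the Jensen formula for the convex piecewise linear function \<open>C(f)\<close> turns
  \<open>N(r, - C(f))\<close> into \<open>1/2 (C(f)(r) + C(f)(- r)) - C(f)(0)\<close>, while \<open>T\<^sub>f(r)\<close> is by definition the
  corresponding average of \<open>G\<close>.  At a point \<open>x\<close> two estimates are needed.

  The first is linear algebra and holds everywhere: for an independent family \<open>K\<close> the sum of the
  Weil functions is at most \<open>\<Sum>\<^sub>i (G(x) - f\<^sub>i(x)) + O(1)\<close>.  Independence yields an injective choice
  of coordinates \<open>k \<mapsto> p k\<close> with all entries \<open>a k (p k)\<close> finite
  (\<open>independent_family_has_matching\<close>).  Since \<open>P\<^sub>k(f) \<ge> a k (p k) + f\<^bsub>p k\<^esub>\<close>, each Weil function costs
  at most one of the non-negative gaps \<open>G - f\<^sub>i\<close>, and different hyperplanes use different gaps.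

  The second is the estimate \<open>C(f)(x) \<le> \<Sum>\<^sub>i f\<^sub>i(x) + o(T\<^sub>f)\<close>, which replaces the shifted values in the
  Casorati determinant by values at \<open>x\<close>.  All increments of the \<open>f\<^sub>i\<close> over a bounded shift are controlled by
  the increment over the interval \<open>[r, r + s]\<close> of one increasing function \<open>u\<close>
  (\<open>shift_majorant\<close>), built from the \<open>f\<^sub>i(r)\<close>, the \<open>f\<^sub>i(- r)\<close> and a linear correction.  Convexity makes \<open>u\<close>
  increasing, and \<open>u = O(T\<^sub>f)\<close> because nondegeneracy forces \<open>T\<^sub>f\<close> to grow at least linearly
  (\<open>trop_T_linear_growth\<close>).  So \<open>ln u\<close> is \<open>o(r)\<close>; as the integral of
  \<open>ln u(r + s) - ln u(r)\<close> over \<open>[1, R]\<close> telescopes to at most \<open>s ln u(R + s) = o(R)\<close>, this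
  difference can be bounded away from zero only on a set of zero upper density
  (\<open>slow_growth_shift\<close>).  Off that set \<open>u(r + s) - u(r) = o(u(r)) = o(T\<^sub>f(r))\<close>.
\<close>

section \<open>Linear independence and the Weil functions\<close>

text \<open>
  A system of distinct coordinates in which the vectors \<open>v k\<close>, \<open>k \<in> S\<close>, have finite entries, that is,
  a finite term in the expansion of a maximal tropical minor.
\<close>

definition matching :: "nat \<Rightarrow> (nat \<Rightarrow> nat \<Rightarrow> ereal) \<Rightarrow> nat set \<Rightarrow> (nat \<Rightarrow> nat) \<Rightarrow> bool" where
  "matching n v S p \<longleftrightarrow> inj_on p S \<and> (\<forall>k\<in>S. p k \<le> n \<and> v k (p k) \<noteq> -\<infinity>)"

text \<open>
  Tropical Cramer's rule.  The coefficient of \<open>v i\<close> is the maximal weight of a matching of the other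
  vectors of \<open>S\<close>.  If the maximum in column \<open>j\<close> is finite and attained at \<open>i0\<close>, then an optimal
  matching \<open>p\<close> of \<open>S - {i0}\<close> must use the column \<open>j\<close>, since otherwise \<open>i0 \<mapsto> j\<close> would extend it to
  all of \<open>S\<close>.  Handing \<open>j\<close> over from the vector \<open>i1\<close> that uses it to \<open>i0\<close> gives a matching of
  \<open>S - {i1}\<close>, which shows that the maximum in column \<open>j\<close> is attained at \<open>i1\<close> too.  A column with
  maximum \<open>-\<infinity>\<close> is harmless because \<open>S\<close> has two elements.
\<close>

lemma critical_family_dependent:
  assumes fin: "finite K" and SK: "S \<subseteq> K"
    and v: "\<And>k j. k \<in> K \<Longrightarrow> j \<le> n \<Longrightarrow> v k j \<noteq> \<infinity>"
    and none: "\<nexists>p. matching n v S p"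
    and one_less: "\<And>i. i \<in> S \<Longrightarrow> \<exists>p. matching n v (S - {i}) p"
    and two: "a \<in> S" "b \<in> S" "a \<noteq> b"
  shows "trop_lin_dependent n K v"
proof -
  have finS: "finite S" using SK fin finite_subset by blast
  define M where "M = (\<lambda>i. {p \<in> (S - {i}) \<rightarrow>\<^sub>E {..n}. matching n v (S - {i}) p})"
  define w where "w = (\<lambda>i p. \<Sum>k\<in>S - {i}. real_of_ereal (v k (p k)))"
  \<comment> \<open>The largest finite term of the minor without row \<open>i\<close>; vectors outside \<open>S\<close> do not take part in the relation.\<close>
  define \<alpha> where "\<alpha> = (\<lambda>i. if i \<in> S then ereal (Max (w i ` M i)) else -\<infinity>)"
  have finM: "finite (M i)" for i
    unfolding M_def using finS by (intro finite_subset[OF _ finite_PiE[of "S - {i}" "\<lambda>_. {..n}"]]) auto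
  have in_M: "restrict p (S - {i}) \<in> M i" "w i (restrict p (S - {i})) = w i p"
    if "matching n v (S - {i}) p" for i p
  proof -
    have "matching n v (S - {i}) (restrict p (S - {i}))"
      using that by (simp add: matching_def inj_on_def)
    then show "restrict p (S - {i}) \<in> M i"
      unfolding M_def by (simp add: matching_def PiE_iff)
    show "w i (restrict p (S - {i})) = w i p" unfolding w_def by (rule sum.cong) simp_all
  qed
  have neM: "M i \<noteq> {}" if "i \<in> S" for i
    using one_less[OF that] in_M(1) by blast
  have \<alpha>_ge: "ereal (w i p) \<le> \<alpha> i" if "i \<in> S" "matching n v (S - {i}) p" for i p
  proof -
    have "w i p \<in> w i ` M i" using in_M[OF that(2)] by (metis image_eqI)
    then show ?thesis using finM that(1) by (simp add: \<alpha>_def)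
  qed
  have "max_attained_twice K (\<lambda>i. \<alpha> i + v i j)" if j: "j \<le> n" for j
  proof -
    define t where "t = (\<lambda>i. \<alpha> i + v i j)"
    have Kne: "K \<noteq> {}" using two SK by auto
    have t_le: "t i \<le> Max (t ` K)" if "i \<in> K" for i using fin that by simp
    have "Max (t ` K) \<in> t ` K" using fin Kne by (intro Max_in) auto
    then obtain i0 where i0: "i0 \<in> K" "t i0 = Max (t ` K)" by force
    show ?thesis
    proof (cases "t i0 = -\<infinity>")
      case True
      then have "t i = Max (t ` K)" if "i \<in> K" for i using t_le[OF that] i0 by simp
      then show ?thesis unfolding max_attained_twice_def t_def[symmetric]
        using two SK by blast
    next
      case False
      have i0S: "i0 \<in> S" and vi0: "v i0 j \<noteq> -\<infinity>"
        using False v[OF i0(1) j] by (auto simp: t_def \<alpha>_def split: if_splits)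
      have "Max (w i0 ` M i0) \<in> w i0 ` M i0" using finM neM[OF i0S] by (intro Max_in) auto
      then obtain p where p: "p \<in> M i0" "w i0 p = Max (w i0 ` M i0)" by force
      have mp: "matching n v (S - {i0}) p" using p by (simp add: M_def)
      have "j \<in> p ` (S - {i0})"
      proof (rule ccontr)
        assume "j \<notin> p ` (S - {i0})"
        then have "matching n v S (p(i0 := j))"
          using mp vi0 j by (auto simp: matching_def inj_on_def)
        then show False using none by blast
      qed
      then obtain i1 where i1: "i1 \<in> S" "i1 \<noteq> i0" "p i1 = j" by auto
      define p' where "p' = p(i0 := j)"
      have mp': "matching n v (S - {i1}) p'"
        using mp vi0 j i1 by (auto simp: matching_def inj_on_def p'_def)
      have "w i0 p = real_of_ereal (v i1 j) + (\<Sum>k\<in>S - {i0} - {i1}. real_of_ereal (v k (p k)))"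
        unfolding w_def using i1 finS by (subst sum.remove[of _ i1]) auto
      moreover have "w i1 p' = real_of_ereal (v i0 j) + (\<Sum>k\<in>S - {i1} - {i0}. real_of_ereal (v k (p' k)))"
        unfolding w_def using i1 i0S finS by (subst sum.remove[of _ i0]) (auto simp: p'_def)
      moreover have "(\<Sum>k\<in>S - {i1} - {i0}. real_of_ereal (v k (p' k)))
          = (\<Sum>k\<in>S - {i0} - {i1}. real_of_ereal (v k (p k)))"
        by (rule sum.cong) (auto simp: p'_def)
      ultimately have ww: "w i1 p' + real_of_ereal (v i1 j) = w i0 p + real_of_ereal (v i0 j)"
        by simp
      have vi1: "v i1 j \<noteq> -\<infinity>" using mp i1 by (auto simp: matching_def)
      have "\<bar>v i0 j\<bar> \<noteq> \<infinity>" "\<bar>v i1 j\<bar> \<noteq> \<infinity>" using vi0 vi1 v j i0 i1 SK by auto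
      then have "t i0 = ereal (w i0 p + real_of_ereal (v i0 j))"
        "ereal (w i1 p') + v i1 j = ereal (w i1 p' + real_of_ereal (v i1 j))"
        using p(2) i0S by (auto simp: t_def \<alpha>_def)
      then have "t i0 = ereal (w i1 p') + v i1 j" by (simp add: ww)
      also have "\<dots> \<le> t i1" unfolding t_def using \<alpha>_ge[OF i1(1) mp'] by (rule add_right_mono)
      finally have "t i1 = Max (t ` K)" using t_le[of i1] i0 i1 SK by (metis antisym subsetD)
      then show ?thesis unfolding max_attained_twice_def t_def[symmetric]
        using i0 i1 SK by blast
    qed
  qed
  moreover have "\<alpha> a \<noteq> -\<infinity>" "a \<in> K" "\<forall>i\<in>K. \<alpha> i \<noteq> \<infinity>"
    using two SK by (auto simp: \<alpha>_def)
  ultimately show ?thesis unfolding trop_lin_dependent_def by blast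
qed

text \<open>
  A family without a matching contains a minimal subfamily without one.  It has at least two
  members, as a single non-zero vector has a finite entry, and each member can be left out to obtain
  a matching, so Cramer's rule makes the family dependent.
\<close>

lemma independent_family_has_matching:
  assumes fin: "finite K" and v: "\<And>k. k \<in> K \<Longrightarrow> v k \<in> trop_nonzero_vectors n"
    and ind: "trop_lin_independent n K v"
  obtains p where "matching n v K p"
proof -
  have "\<exists>p. matching n v K p"
  proof (rule ccontr)
    assume "\<nexists>p. matching n v K p"
    then have "K \<in> {S \<in> Pow K. \<nexists>p. matching n v S p}" by blast
    moreover have "finite {S \<in> Pow K. \<nexists>p. matching n v S p}" using fin by simp
    ultimately obtain S where S_in: "S \<in> {S \<in> Pow K. \<nexists>p. matching n v S p}"
      and S_min: "\<forall>T\<in>{S \<in> Pow K. \<nexists>p. matching n v S p}. T \<subseteq> S \<longrightarrow> S = T"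
      using finite_has_minimal2 by meson
    have S: "S \<subseteq> K" "\<nexists>p. matching n v S p" using S_in by auto
    have min: "T = S" if "T \<subseteq> S" "\<nexists>p. matching n v T p" for T
    proof -
      have "T \<in> {S \<in> Pow K. \<nexists>p. matching n v S p}" using that S(1) by simp
      then show ?thesis using S_min that(1) by metis
    qed
    have one_less: "\<exists>p. matching n v (S - {i}) p" if "i \<in> S" for i
      using min[of "S - {i}"] that by blast
    obtain i where i: "i \<in> S" using S(2) by (force simp: matching_def)
    obtain j where j: "j \<le> n" "v i j \<noteq> -\<infinity>"
      using v[of i] i S(1) by (auto simp: trop_nonzero_vectors_def)
    have "S \<noteq> {i}"
    proof
      assume "S = {i}"
      then have "matching n v S (\<lambda>_. j)" using j by (auto simp: matching_def)
      then show False using S(2) by blast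
    qed
    then obtain i' where i': "i' \<in> S" "i' \<noteq> i" using i by blast
    have "trop_lin_dependent n K v"
      by (rule critical_family_dependent[OF fin S(1) _ S(2) one_less i i'(1)])
        (use v i' in \<open>auto simp: trop_nonzero_vectors_def\<close>)
    then show False using ind by contradiction
  qed
  then show ?thesis using that by blast
qed

lemma curve_norm_ge: "i \<le> n \<Longrightarrow> f i x \<le> curve_norm n f x"
  by (auto simp: curve_norm_def)

text \<open>
  The tropical linear form is bounded below by any one of its terms with a finite coefficient.
\<close>

lemma weil_function_le:
  assumes a: "a \<in> trop_nonzero_vectors n" and i: "i \<le> n" "a i \<noteq> -\<infinity>"
  shows "weil_function n a f x
    \<le> real_of_ereal (coeff_norm n a) - real_of_ereal (a i) + (curve_norm n f x - f i x)"
proof -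
  have not_inf: "\<forall>j\<le>n. a j \<noteq> \<infinity>" using a by (auto simp: trop_nonzero_vectors_def)
  have "coeff_norm n a \<in> a ` {..n}"
    unfolding coeff_norm_def by (rule Max_in) auto
  then have "coeff_norm n a \<noteq> \<infinity>" using not_inf by auto
  moreover have "a i \<le> coeff_norm n a" using i by (auto simp: coeff_norm_def)
  ultimately have c: "\<bar>coeff_norm n a\<bar> \<noteq> \<infinity>" using i by (cases "coeff_norm n a") auto
  have "trop_linear_comp n a f x \<in> (\<lambda>i. a i + ereal (f i x)) ` {..n}"
    unfolding trop_linear_comp_def by (rule Max_in) auto
  then have "trop_linear_comp n a f x \<noteq> \<infinity>" using not_inf by auto
  moreover have P: "a i + ereal (f i x) \<le> trop_linear_comp n a f x"
    using i by (auto simp: trop_linear_comp_def)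
  ultimately have p: "\<bar>trop_linear_comp n a f x\<bar> \<noteq> \<infinity>"
    using i by (cases "trop_linear_comp n a f x"; cases "a i") auto
  have ai: "\<bar>a i\<bar> \<noteq> \<infinity>" using not_inf i by auto
  show ?thesis
    using c p ai P unfolding weil_function_def
    by (cases "coeff_norm n a"; cases "trop_linear_comp n a f x"; cases "a i") auto
qed

text \<open>
  The matching charges the hyperplanes to distinct coordinates, and the coordinates that are not
  charged contribute non-negative terms on the right.  The constant is taken over all pairs so that
  it depends neither on \<open>K\<close> nor on \<open>x\<close>.
\<close>

lemma sum_weil_function_le:
  assumes K: "K \<subseteq> {1..q}" and ind: "trop_lin_independent n K a"
    and a: "\<And>k. k \<in> {1..q} \<Longrightarrow> a k \<in> trop_nonzero_vectors n"
  shows "(\<Sum>k\<in>K. weil_function n (a k) f x)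
    \<le> (\<Sum>k\<in>{1..q}. \<Sum>i\<le>n. \<bar>real_of_ereal (coeff_norm n (a k)) - real_of_ereal (a k i)\<bar>)
      + (\<Sum>i\<le>n. curve_norm n f x - f i x)"
proof -
  let ?d = "\<lambda>k i. \<bar>real_of_ereal (coeff_norm n (a k)) - real_of_ereal (a k i)\<bar>"
  have fin: "finite K" using K finite_subset by blast
  obtain p where p: "matching n a K p"
    using independent_family_has_matching[OF fin _ ind] a K by blast
  have "(\<Sum>k\<in>K. weil_function n (a k) f x)
      \<le> (\<Sum>k\<in>K. ?d k (p k) + (curve_norm n f x - f (p k) x))"
  proof (rule sum_mono)
    fix k assume "k \<in> K"
    then show "weil_function n (a k) f x \<le> ?d k (p k) + (curve_norm n f x - f (p k) x)"
      using weil_function_le[of "a k" n "p k" f x] a[of k] p K by (force simp: matching_def)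
  qed
  also have "\<dots> = (\<Sum>k\<in>K. ?d k (p k)) + (\<Sum>k\<in>K. curve_norm n f x - f (p k) x)"
    by (simp add: sum.distrib)
  also have "(\<Sum>k\<in>K. ?d k (p k)) \<le> (\<Sum>k\<in>K. \<Sum>i\<le>n. ?d k i)"
    using p by (intro sum_mono member_le_sum) (auto simp: matching_def)
  also have "(\<Sum>k\<in>K. \<Sum>i\<le>n. ?d k i) \<le> (\<Sum>k\<in>{1..q}. \<Sum>i\<le>n. ?d k i)"
    using K by (intro sum_mono2) (auto intro: sum_nonneg)
  also have "(\<Sum>k\<in>K. curve_norm n f x - f (p k) x) = (\<Sum>i\<in>p ` K. curve_norm n f x - f i x)"
    using p by (subst sum.reindex) (auto simp: matching_def)
  also have "\<dots> \<le> (\<Sum>i\<le>n. curve_norm n f x - f i x)"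
    using p by (intro sum_mono2) (auto simp: matching_def curve_norm_ge)
  finally show ?thesis by simp
qed

lemma max_weil_sum_le:
  assumes "\<And>k. k \<in> {1..q} \<Longrightarrow> a k \<in> trop_nonzero_vectors n"
  shows "(MAX K\<in>{K. K \<subseteq> {1..q} \<and> trop_lin_independent n K a}.
      1/2 * (\<Sum>k\<in>K. weil_function n (a k) f x))
    \<le> 1/2 * ((\<Sum>k\<in>{1..q}. \<Sum>i\<le>n. \<bar>real_of_ereal (coeff_norm n (a k)) - real_of_ereal (a k i)\<bar>)
      + (\<Sum>i\<le>n. curve_norm n f x - f i x))"
proof (rule Max.boundedI)
  have "{} \<in> {K. K \<subseteq> {1..q} \<and> trop_lin_independent n K a}"
    by (simp add: trop_lin_dependent_def)
  then show "(\<lambda>K. 1/2 * (\<Sum>k\<in>K. weil_function n (a k) f x)) `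
      {K. K \<subseteq> {1..q} \<and> trop_lin_independent n K a} \<noteq> {}" by blast
next
  fix y assume "y \<in> (\<lambda>K. 1/2 * (\<Sum>k\<in>K. weil_function n (a k) f x)) `
      {K. K \<subseteq> {1..q} \<and> trop_lin_independent n K a}"
  then obtain K where K: "K \<subseteq> {1..q}" "trop_lin_independent n K a"
    and y: "y = 1/2 * (\<Sum>k\<in>K. weil_function n (a k) f x)" by blast
  show "y \<le> 1/2 * ((\<Sum>k\<in>{1..q}. \<Sum>i\<le>n. \<bar>real_of_ereal (coeff_norm n (a k)) - real_of_ereal (a k i)\<bar>)
      + (\<Sum>i\<le>n. curve_norm n f x - f i x))"
    unfolding y by (intro mult_left_mono sum_weil_function_le K assms) simp_all
qed simp

section \<open>Germs of piecewise linear functions\<close>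

text \<open>
  Near \<open>x\<close> the function \<open>g\<close> has slope \<open>l\<close> to the left and slope \<open>r\<close> to the right.  The form with
  \<^const>\<open>min\<close> and \<^const>\<open>max\<close> is linear in \<open>(l, r)\<close> and visibly continuous.
\<close>

definition slope_germ :: "(real \<Rightarrow> real) \<Rightarrow> real \<Rightarrow> real \<Rightarrow> real \<Rightarrow> bool" where
  "slope_germ g x l r \<longleftrightarrow>
     (\<forall>\<^sub>F y in nhds x. g y = g x + l * min (y - x) 0 + r * max (y - x) 0)"

text \<open>
  A local description of tropical entire functions.  It is easily seen to be stable under sums, shifts and
  maxima, unlike a description by the points of non-differentiability.
\<close>

definition locally_convex_pl :: "(real \<Rightarrow> real) \<Rightarrow> bool" where
  "locally_convex_pl g \<longleftrightarrow> (\<forall>x. \<exists>l r. l \<le> r \<and> slope_germ g x l r)"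

lemma slope_germ_isCont: "slope_germ g x l r \<Longrightarrow> isCont g x"
proof -
  assume "slope_germ g x l r"
  then have ev: "\<forall>\<^sub>F y in nhds x. g y = g x + l * min (y - x) 0 + r * max (y - x) 0"
    by (simp add: slope_germ_def)
  have "isCont (\<lambda>y. g x + l * min (y - x) 0 + r * max (y - x) 0) x"
    by (intro continuous_intros)
  then show ?thesis using isCont_cong[OF ev] by simp
qed

lemma slope_germ_same_iff:
  "slope_germ g x m m \<longleftrightarrow> (\<forall>\<^sub>F y in nhds x. g y = g x + m * (y - x))"
proof -
  have "m * min (y - x) 0 + m * max (y - x) 0 = m * (y - x)" for y :: real
    by (auto simp: min_def max_def)
  then show ?thesis by (simp add: slope_germ_def add.assoc)
qed

lemma slope_germ_same_deriv: "slope_germ g x m m \<Longrightarrow> (g has_real_derivative m) (at x)"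
proof -
  assume "slope_germ g x m m"
  then have ev: "\<forall>\<^sub>F y in nhds x. g y = g x + m * (y - x)"
    by (simp add: slope_germ_same_iff)
  have "((\<lambda>y. g x + m * (y - x)) has_real_derivative m) (at x)"
    by (auto intro!: derivative_eq_intros)
  then show ?thesis using DERIV_cong_ev[OF refl ev refl] by simp
qed

text \<open>
  A piecewise linear function is affine around every point close to \<open>x\<close> but different from it; this
  gives the values of the derivative that enter \<^const>\<open>trop_omega\<close> and the discreteness of the roots.
\<close>

lemma slope_germ_punctured_nbhd:
  assumes "slope_germ g x l r"
  shows "\<forall>\<^sub>F y in at x. slope_germ g y (if y < x then l else r) (if y < x then l else r)"
proof -
  let ?a = "\<lambda>y. g x + l * min (y - x) 0 + r * max (y - x) 0"
  have ev: "\<forall>\<^sub>F y in nhds x. \<forall>\<^sub>F z in nhds y. g z = ?a z"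
    using assms unfolding slope_germ_def eventually_eventually .
  then have "\<forall>\<^sub>F y in at x. y \<noteq> x \<and> g y = ?a y \<and> (\<forall>\<^sub>F z in nhds y. g z = ?a z)"
    unfolding eventually_at_filter
  proof (rule eventually_mono)
    fix y assume y: "\<forall>\<^sub>F z in nhds y. g z = ?a z"
    have "g y = ?a y" using y by (rule eventually_nhds_x_imp_x)
    with y show "y \<noteq> x \<longrightarrow> y \<in> UNIV \<longrightarrow> y \<noteq> x \<and> g y = ?a y \<and> (\<forall>\<^sub>F z in nhds y. g z = ?a z)" by blast
  qed
  then show ?thesis
  proof (rule eventually_mono)
    fix y assume y: "y \<noteq> x \<and> g y = ?a y \<and> (\<forall>\<^sub>F z in nhds y. g z = ?a z)"
    show "slope_germ g y (if y < x then l else r) (if y < x then l else r)"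
    proof (cases "y < x")
      case True
      then have "\<forall>\<^sub>F z in nhds y. z < x"
        by (intro eventually_nhds_in_open[of "{..<x}", simplified]) auto
      with y have "\<forall>\<^sub>F z in nhds y. g z = ?a z \<and> z < x"
        by (auto intro: eventually_conj)
      then have "\<forall>\<^sub>F z in nhds y. g z = g y + l * (z - y)"
        by (rule eventually_mono) (use y True in \<open>auto simp: algebra_simps\<close>)
      then show ?thesis using True by (simp add: slope_germ_same_iff)
    next
      case False
      then have xy: "x < y" using y by simp
      then have "\<forall>\<^sub>F z in nhds y. x < z"
        by (intro eventually_nhds_in_open[of "{x<..}", simplified]) auto
      with y have "\<forall>\<^sub>F z in nhds y. g z = ?a z \<and> x < z"
        by (auto intro: eventually_conj)
      then have "\<forall>\<^sub>F z in nhds y. g z = g y + r * (z - y)"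
        by (rule eventually_mono) (use y xy in \<open>auto simp: algebra_simps\<close>)
      then show ?thesis using False by (simp add: slope_germ_same_iff)
    qed
  qed
qed

lemma trop_omega_slope_germ:
  assumes "slope_germ g x l r" shows "trop_omega g x = r - l"
proof -
  have "\<forall>\<^sub>F y in at x. deriv g y = (if y < x then l else r)"
    using slope_germ_punctured_nbhd[OF assms]
    by (rule eventually_mono) (rule DERIV_imp_deriv[OF slope_germ_same_deriv])
  then obtain d where d: "d > 0"
    "\<And>y. y \<noteq> x \<Longrightarrow> dist y x < d \<Longrightarrow> deriv g y = (if y < x then l else r)"
    by (auto simp: eventually_at)
  have "\<forall>\<^sub>F \<epsilon> in at_right 0. deriv g (x + \<epsilon>) - deriv g (x - \<epsilon>) = r - l"
    unfolding eventually_at_right_field using d(1)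
    by (intro exI[of _ d]) (auto simp: d(2) dist_real_def)
  then have "((\<lambda>\<epsilon>. deriv g (x + \<epsilon>) - deriv g (x - \<epsilon>)) \<longlongrightarrow> r - l) (at_right 0)"
    by (rule tendsto_eventually)
  then show ?thesis unfolding trop_omega_def by (intro tendsto_Lim) auto
qed

lemma slope_germ_uminus: "slope_germ g x l r \<Longrightarrow> slope_germ (\<lambda>y. - g y) x (- l) (- r)"
  unfolding slope_germ_def by (erule eventually_mono) simp

lemma slope_germ_add:
  assumes "slope_germ g x l r" "slope_germ h x l' r'"
  shows "slope_germ (\<lambda>y. g y + h y) x (l + l') (r + r')"
  using eventually_conj[OF assms[unfolded slope_germ_def]] unfolding slope_germ_def
  by (rule eventually_mono) (simp add: algebra_simps)

lemma locally_convex_pl_add: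
  assumes "locally_convex_pl g" "locally_convex_pl h"
  shows "locally_convex_pl (\<lambda>x. g x + h x)"
  unfolding locally_convex_pl_def
proof
  fix x
  obtain l r l' r' where "l \<le> r" "slope_germ g x l r" "l' \<le> r'" "slope_germ h x l' r'"
    using assms unfolding locally_convex_pl_def by blast
  then have "l + l' \<le> r + r' \<and> slope_germ (\<lambda>x. g x + h x) x (l + l') (r + r')"
    by (simp add: slope_germ_add)
  then show "\<exists>l r. l \<le> r \<and> slope_germ (\<lambda>x. g x + h x) x l r" by blast
qed

lemma locally_convex_pl_zero: "locally_convex_pl (\<lambda>x. 0)"
  unfolding locally_convex_pl_def slope_germ_def
  by (intro allI exI[of _ "0 :: real"]) simp

lemma locally_convex_pl_sum:
  "finite I \<Longrightarrow> (\<And>i. i \<in> I \<Longrightarrow> locally_convex_pl (g i)) \<Longrightarrow> locally_convex_pl (\<lambda>x. \<Sum>i\<in>I. g i x)"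
  by (induction I rule: finite_induct) (auto intro: locally_convex_pl_add locally_convex_pl_zero)

lemma locally_convex_pl_shift:
  assumes "locally_convex_pl g" shows "locally_convex_pl (\<lambda>x. g (x + d))"
  unfolding locally_convex_pl_def
proof
  fix x
  obtain l r where lr: "l \<le> r" "slope_germ g (x + d) l r"
    using assms unfolding locally_convex_pl_def by blast
  have "filterlim (\<lambda>y. y + d) (nhds (x + d)) (nhds x)"
    by (rule tendsto_add[OF filterlim_ident tendsto_const])
  then have "\<forall>\<^sub>F y in nhds x. g (y + d)
      = g (x + d) + l * min (y + d - (x + d)) 0 + r * max (y + d - (x + d)) 0"
    using eventually_compose_filterlim[OF lr(2)[unfolded slope_germ_def]] by blast
  then show "\<exists>l r. l \<le> r \<and> slope_germ (\<lambda>x. g (x + d)) x l r"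
    using lr(1) by (auto simp: slope_germ_def)
qed

lemma slope_germ_cong:
  "slope_germ g x l r \<Longrightarrow> (\<forall>\<^sub>F y in nhds x. h y = g y) \<Longrightarrow> slope_germ h x l r"
proof -
  assume g: "slope_germ g x l r" and h: "\<forall>\<^sub>F y in nhds x. h y = g y"
  have "h x = g x" using h by (rule eventually_nhds_x_imp_x)
  then show "slope_germ h x l r"
    using eventually_conj[OF g[unfolded slope_germ_def] h] unfolding slope_germ_def
    by (auto elim!: eventually_mono)
qed

text \<open>
  If the values at \<open>x\<close> differ, one function dominates in a neighbourhood.  If they agree, the maximum
  of the two germs takes the smaller slope on the left and the larger one on the right.
\<close>

lemma slope_germ_max:
  assumes g: "slope_germ g x l r" "l \<le> r" and h: "slope_germ h x l' r'" "l' \<le> r'"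
  shows "\<exists>l r. l \<le> r \<and> slope_germ (\<lambda>y. max (g y) (h y)) x l r"
proof -
  have cont: "(g \<longlongrightarrow> g x) (nhds x)" "(h \<longlongrightarrow> h x) (nhds x)"
    using slope_germ_isCont[OF g(1)] slope_germ_isCont[OF h(1)]
    by (simp_all add: isCont_def tendsto_at_iff_tendsto_nhds)
  consider "g x < h x" | "h x < g x" | "g x = h x" by linarith
  then show ?thesis
  proof cases
    case 1
    then have "\<forall>\<^sub>F y in nhds x. 0 < h y - g y"
      using order_tendstoD(1)[OF tendsto_diff[OF cont(2) cont(1)], of 0] by simp
    then have "\<forall>\<^sub>F y in nhds x. max (g y) (h y) = h y"
      by (rule eventually_mono) simp
    then show ?thesis using slope_germ_cong[OF h(1), of "\<lambda>y. max (g y) (h y)"] h(2) by blast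
  next
    case 2
    then have "\<forall>\<^sub>F y in nhds x. 0 < g y - h y"
      using order_tendstoD(1)[OF tendsto_diff[OF cont(1) cont(2)], of 0] by simp
    then have "\<forall>\<^sub>F y in nhds x. max (g y) (h y) = g y"
      by (rule eventually_mono) simp
    then show ?thesis using slope_germ_cong[OF g(1), of "\<lambda>y. max (g y) (h y)"] g(2) by blast
  next
    case 3
    have "slope_germ (\<lambda>y. max (g y) (h y)) x (min l l') (max r r')"
      using eventually_conj[OF g(1)[unfolded slope_germ_def] h(1)[unfolded slope_germ_def]]
      unfolding slope_germ_def
    proof (rule eventually_mono)
      fix y
      assume "g y = g x + l * min (y - x) 0 + r * max (y - x) 0 \<and>
        h y = h x + l' * min (y - x) 0 + r' * max (y - x) 0"
      then have *: "g y = g x + l * min (y - x) 0 + r * max (y - x) 0"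
        "h y = h x + l' * min (y - x) 0 + r' * max (y - x) 0" by auto
      show "max (g y) (h y) = max (g x) (h x) + min l l' * min (y - x) 0 + max r r' * max (y - x) 0"
        using 3 unfolding *
        by (cases "y < x") (simp_all add: min_mult_distrib_right max_mult_distrib_right max_add_distrib_right)
    qed
    moreover have "min l l' \<le> max r r'" using g(2) by simp
    ultimately show ?thesis by blast
  qed
qed

section \<open>Convexity and the Jensen formula\<close>

lemma locally_convex_pl_max:
  "locally_convex_pl g \<Longrightarrow> locally_convex_pl h \<Longrightarrow> locally_convex_pl (\<lambda>x. max (g x) (h x))"
  unfolding locally_convex_pl_def using slope_germ_max by blast

lemma locally_convex_pl_Max:
  assumes "finite I" "I \<noteq> {}" "\<And>i. i \<in> I \<Longrightarrow> locally_convex_pl (g i)"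
  shows "locally_convex_pl (\<lambda>x. MAX i\<in>I. g i x)"
  using assms
proof (induction I rule: finite_ne_induct)
  case (insert i I)
  then have "locally_convex_pl (\<lambda>x. max (g i x) (MAX i\<in>I. g i x))"
    by (intro locally_convex_pl_max) auto
  then show ?case using insert by simp
qed simp

lemma locally_convex_pl_casorati:
  assumes "\<And>i. i \<le> n \<Longrightarrow> locally_convex_pl (f i)"
  shows "locally_convex_pl (trop_casorati n c f)"
proof -
  have "{\<pi>. \<pi> permutes {..n}} \<noteq> {}" using permutes_id by blast
  moreover have "finite {\<pi>. \<pi> permutes {..n}}" by (simp add: finite_permutations)
  ultimately show ?thesis
    unfolding trop_casorati_def
    by (intro locally_convex_pl_Max locally_convex_pl_sum locally_convex_pl_shift) (auto intro: assms)
qed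

text \<open>
  Stated for a filter \<open>F\<close> so that it covers both \<^term>\<open>at_left x\<close> and \<^term>\<open>at_right x\<close>.
\<close>

lemma affine_extends_to_endpoint:
  fixes g :: "real \<Rightarrow> real"
  assumes F: "F \<noteq> bot" "F \<le> at x" and cont: "isCont g x"
    and ev: "\<forall>\<^sub>F y in F. g y = m * y + d"
  shows "g x = m * x + d"
proof -
  have "(g \<longlongrightarrow> g x) F" using cont F(2) unfolding isCont_def by (rule tendsto_mono[rotated])
  moreover have "((\<lambda>y. m * y + d) \<longlongrightarrow> m * x + d) F"
    by (rule tendsto_mono[OF F(2)]) (intro tendsto_intros)
  ultimately show ?thesis
    using tendsto_cong[OF ev] tendsto_unique[OF F(1)] by blast
qed

text \<open>
  There are finitely many points of non-differentiability near \<open>x\<close>, so the function is affine on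
  both sides of \<open>x\<close>, and the absence of a pole at \<open>x\<close> orders the two slopes.
\<close>

lemma trop_entire_locally_convex_pl:
  assumes "trop_entire g" shows "locally_convex_pl g"
  unfolding locally_convex_pl_def
proof
  fix x
  have cont: "isCont g x" and fin: "finite {y \<in> {x-1..x+1}. \<not> g differentiable (at y)}"
    and affine: "\<And>a b. (\<forall>y\<in>{a<..<b}. g differentiable (at y)) \<Longrightarrow>
            (\<exists>m d. \<forall>y\<in>{a<..<b}. g y = m * y + d)"
    and no_pole: "\<not> trop_pole g x"
    using assms by (auto simp: trop_entire_def trop_meromorphic_def continuous_on_eq_continuous_at)
  obtain d where d: "d > 0"
    "\<And>y. y \<in> {x-1..x+1} \<Longrightarrow> \<not> g differentiable (at y) \<Longrightarrow> y \<noteq> x \<Longrightarrow> d \<le> dist x y"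
    using finite_set_avoid[OF fin, of x] by auto
  define e where "e = min d 1"
  have e: "e > 0" using d(1) by (simp add: e_def)
  have diff: "g differentiable (at y)" if "y \<noteq> x" "\<bar>x - y\<bar> < e" for y
    using d(2)[of y] that by (force simp: e_def dist_real_def)
  obtain l d1 where l: "\<forall>y\<in>{x-e<..<x}. g y = l * y + d1"
    using affine[of "x - e" x] diff by force
  obtain r d2 where r: "\<forall>y\<in>{x<..<x+e}. g y = r * y + d2"
    using affine[of x "x + e"] diff by force
  have "\<forall>\<^sub>F y in at_left x. g y = l * y + d1"
    unfolding eventually_at_left_field using l e by (intro exI[of _ "x - e"]) auto
  then have gl: "g x = l * x + d1"
    by (intro affine_extends_to_endpoint[OF _ _ cont]) (auto simp: at_le)
  have "\<forall>\<^sub>F y in at_right x. g y = r * y + d2"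
    unfolding eventually_at_right_field using r e by (intro exI[of _ "x + e"]) auto
  then have gr: "g x = r * x + d2"
    by (intro affine_extends_to_endpoint[OF _ _ cont]) (auto simp: at_le)
  have "\<forall>\<^sub>F y in nhds x. y \<in> {x-e<..<x+e}"
    using e by (intro eventually_nhds_in_open) auto
  then have "slope_germ g x l r"
    unfolding slope_germ_def
  proof (rule eventually_mono)
    fix y assume y: "y \<in> {x-e<..<x+e}"
    consider "y < x" | "y = x" | "x < y" by linarith
    then show "g y = g x + l * min (y - x) 0 + r * max (y - x) 0"
    proof cases
      case 1
      then have "g y = l * y + d1" using l y by simp
      with 1 gl show ?thesis by (simp add: algebra_simps)
    next
      case 3
      then have "g y = r * y + d2" using r y by simp
      with 3 gr show ?thesis by (simp add: algebra_simps)
    qed simp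
  qed
  moreover from this no_pole have "l \<le> r"
    by (simp add: trop_pole_def trop_omega_slope_germ)
  ultimately show "\<exists>l r. l \<le> r \<and> slope_germ g x l r" by blast
qed

lemma trop_omega_nonneg: "locally_convex_pl g \<Longrightarrow> 0 \<le> trop_omega g x"
  unfolding locally_convex_pl_def using trop_omega_slope_germ[of g x] by (metis diff_ge_0_iff_ge)

lemma trop_omega_uminus: "locally_convex_pl g \<Longrightarrow> trop_omega (\<lambda>y. - g y) x = - trop_omega g x"
proof -
  assume "locally_convex_pl g"
  then obtain l r where "slope_germ g x l r" unfolding locally_convex_pl_def by blast
  then show ?thesis
    using trop_omega_slope_germ slope_germ_uminus by fastforce
qed

text \<open>
  Around any accumulation point the function would be affine on both sides, which leaves no room for
  further roots.
\<close>

lemma finite_nonzero_omega: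
  assumes "locally_convex_pl g" shows "finite {s. \<bar>s\<bar> \<le> R \<and> trop_omega g s \<noteq> 0}"
proof (rule ccontr)
  let ?K = "{s. \<bar>s\<bar> \<le> R \<and> trop_omega g s \<noteq> 0}"
  assume "infinite ?K"
  moreover have "?K \<subseteq> {-R..R}" by auto
  ultimately obtain x where x: "x islimpt ?K"
    using Heine_Borel_imp_Bolzano_Weierstrass[of "{-R..R}" ?K] by auto
  obtain l r where "slope_germ g x l r"
    using assms unfolding locally_convex_pl_def by blast
  then have "\<forall>\<^sub>F y in at x. y \<notin> ?K"
    by (rule eventually_mono[OF slope_germ_punctured_nbhd]) (auto dest: trop_omega_slope_germ)
  then show False using x by (simp add: islimpt_iff_eventually)
qed

lemma slope_germ_cmult: "slope_germ g x l r \<Longrightarrow> slope_germ (\<lambda>y. w * g y) x (w * l) (w * r)"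
  unfolding slope_germ_def by (erule eventually_mono) (simp add: algebra_simps)

lemma slope_germ_sum:
  "finite I \<Longrightarrow> (\<And>i. i \<in> I \<Longrightarrow> slope_germ (g i) x (l i) (r i)) \<Longrightarrow>
    slope_germ (\<lambda>y. \<Sum>i\<in>I. g i y) x (\<Sum>i\<in>I. l i) (\<Sum>i\<in>I. r i)"
proof (induction I rule: finite_induct)
  case empty
  then show ?case by (simp add: slope_germ_def)
next
  case (insert i I)
  then show ?case by (simp add: slope_germ_add)
qed

lemma slope_germ_hinge:
  "slope_germ (\<lambda>y. max (y - s) 0) x (if s < x then 1 else 0) (if s \<le> x then 1 else 0)"
proof -
  consider "s < x" | "s = x" | "x < s" by linarith
  then show ?thesis
  proof cases
    case 1
    then have "\<forall>\<^sub>F y in nhds x. y \<in> {s<..}" by (intro eventually_nhds_in_open) auto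
    then show ?thesis unfolding slope_germ_def
      by (rule eventually_mono) (use 1 in \<open>auto simp: min_def max_def\<close>)
  next
    case 2
    then show ?thesis by (simp add: slope_germ_def)
  next
    case 3
    then have "\<forall>\<^sub>F y in nhds x. y \<in> {..<s}" by (intro eventually_nhds_in_open) auto
    then show ?thesis unfolding slope_germ_def
      by (rule eventually_mono) (use 3 in auto)
  qed
qed

text \<open>
  The derivative is locally constant on a connected set.
\<close>

lemma locally_affine_imp_affine:
  assumes "\<And>x. x \<in> {-R..R} \<Longrightarrow> \<exists>m. slope_germ h x m m"
  shows "\<exists>\<alpha> \<beta>. \<forall>x\<in>{-R..R}. h x = \<alpha> + \<beta> * x"
proof (cases "0 \<le> R")
  case True
  have germ: "slope_germ h x (deriv h x) (deriv h x)" if "x \<in> {-R..R}" for x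
    using assms[OF that] slope_germ_same_deriv DERIV_imp_deriv by metis
  have "\<forall>x\<in>{-R..R}. \<forall>\<^sub>F y in at x within {-R..R}. deriv h x = deriv h y"
  proof
    fix x assume "x \<in> {-R..R}"
    from slope_germ_punctured_nbhd[OF germ[OF this]]
    have "\<forall>\<^sub>F y in at x. deriv h x = deriv h y"
      by (rule eventually_mono) (simp add: DERIV_imp_deriv[OF slope_germ_same_deriv])
    then show "\<forall>\<^sub>F y in at x within {-R..R}. deriv h x = deriv h y"
      using at_le[of "{-R..R}" UNIV x] filter_leD by blast
  qed
  then have const: "deriv h x = deriv h 0" if "x \<in> {-R..R}" for x
    using True that by (intro connected_local_const[of "{-R..R}"]) auto
  have "((\<lambda>x. h x - deriv h 0 * x) has_real_derivative 0) (at x within {-R..R})"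
    if "x \<in> {-R..R}" for x
  proof -
    have "(h has_real_derivative deriv h 0) (at x)"
      using slope_germ_same_deriv[OF germ[OF that]] const[OF that] by simp
    then have "((\<lambda>x. h x - deriv h 0 * x) has_real_derivative 0) (at x)"
      by (auto intro!: derivative_eq_intros)
    then show ?thesis by (rule has_field_derivative_at_within)
  qed
  then obtain \<alpha> where "\<And>x. x \<in> {-R..R} \<Longrightarrow> h x - deriv h 0 * x = \<alpha>"
    using has_field_derivative_zero_constant[of "{-R..R}" "\<lambda>x. h x - deriv h 0 * x"] by auto
  then have "\<forall>x\<in>{-R..R}. h x = \<alpha> + deriv h 0 * x" by (metis add.commute diff_add_cancel)
  then show ?thesis by blast
qed simp

text \<open>
  Subtracting the hinges \<open>\<omega>(s) max(x - s, 0)\<close> at all roots in \<open>[-R, R]\<close> removes every kink there, so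
  what remains is affine.  Convexity and the Jensen formula are both read off from this formula.
\<close>

lemma hinge_representation:
  assumes g: "locally_convex_pl g"
  shows "\<exists>\<alpha> \<beta>. \<forall>x\<in>{-R..R}. g x = \<alpha> + \<beta> * x +
    (\<Sum>s | \<bar>s\<bar> \<le> R \<and> trop_omega g s \<noteq> 0. trop_omega g s * max (x - s) 0)"
proof -
  let ?K = "{s. \<bar>s\<bar> \<le> R \<and> trop_omega g s \<noteq> 0}"
  let ?w = "trop_omega g"
  define k where "k = (\<lambda>x. \<Sum>s\<in>?K. ?w s * max (x - s) 0)"
  have fin: "finite ?K" using finite_nonzero_omega[OF g] .
  have "\<exists>m. slope_germ (\<lambda>y. g y + - k y) x m m" if x: "x \<in> {-R..R}" for x
  proof -
    obtain l r where lr: "slope_germ g x l r"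
      using g unfolding locally_convex_pl_def by blast
    let ?l = "\<Sum>s\<in>?K. ?w s * (if s < x then 1 else 0)"
    let ?r = "\<Sum>s\<in>?K. ?w s * (if s \<le> x then 1 else 0)"
    have "slope_germ k x ?l ?r"
      unfolding k_def using fin by (intro slope_germ_sum slope_germ_cmult slope_germ_hinge)
    then have germ: "slope_germ (\<lambda>y. g y + - k y) x (l + - ?l) (r + - ?r)"
      by (intro slope_germ_add lr slope_germ_uminus)
    \<comment> \<open>Only the hinge at \<open>x\<close> itself has a kink at \<open>x\<close>, of the same size as that of \<open>g\<close>.\<close>
    have "?r - ?l = (\<Sum>s\<in>?K. if s = x then ?w s else 0)"
      unfolding sum_subtractf[symmetric] by (rule sum.cong) auto
    also have "\<dots> = ?w x" using fin x by (auto simp: sum.delta abs_le_iff)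
    also have "?w x = r - l" by (rule trop_omega_slope_germ[OF lr])
    finally have "l + - ?l = r + - ?r" by simp
    with germ show ?thesis by auto
  qed
  then obtain \<alpha> \<beta> where "\<forall>x\<in>{-R..R}. g x + - k x = \<alpha> + \<beta> * x"
    using locally_affine_imp_affine by blast
  then have "\<forall>x\<in>{-R..R}. g x = \<alpha> + \<beta> * x + k x"
    by (auto simp: algebra_simps)
  then show ?thesis unfolding k_def by blast
qed

text \<open>
  On every interval \<open>[-R, R]\<close> the function is affine plus hinges with non-negative weights.
\<close>

lemma locally_convex_pl_convex:
  assumes g: "locally_convex_pl g" shows "convex_on UNIV g"
proof (rule convex_onI)
  fix t x y :: real
  assume t: "0 < t" "t < 1"
  define R where "R = max \<bar>x\<bar> \<bar>y\<bar>"
  let ?K = "{s. \<bar>s\<bar> \<le> R \<and> trop_omega g s \<noteq> 0}"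
  obtain \<alpha> \<beta> where "\<forall>z\<in>{-R..R}. g z = \<alpha> + \<beta> * z +
      (\<Sum>s\<in>?K. trop_omega g s * max (z - s) 0)"
    using hinge_representation[OF g, of R] by blast
  then have rep: "\<And>z. z \<in> {-R..R} \<Longrightarrow> g z = \<alpha> + \<beta> * z +
      (\<Sum>s\<in>?K. trop_omega g s * max (z - s) 0)" by blast
  define z where "z = (1 - t) * x + t * y"
  have xy: "x \<in> {-R..R}" "y \<in> {-R..R}" by (auto simp: R_def)
  then have z: "z \<in> {-R..R}"
    unfolding z_def using t convexD_alt[of "{-R..R}" x y t] by simp
  have hinge: "max (z - s) 0 \<le> (1 - t) * max (x - s) 0 + t * max (y - s) 0" for s
  proof -
    have "z - s = (1 - t) * (x - s) + t * (y - s)" by (simp add: z_def algebra_simps)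
    also have "\<dots> \<le> (1 - t) * max (x - s) 0 + t * max (y - s) 0"
      using t by (intro add_mono mult_left_mono) auto
    finally show ?thesis using t by simp
  qed
  have "(\<Sum>s\<in>?K. trop_omega g s * max (z - s) 0)
      \<le> (\<Sum>s\<in>?K. (1 - t) * (trop_omega g s * max (x - s) 0) + t * (trop_omega g s * max (y - s) 0))"
  proof (rule sum_mono)
    fix s
    have "trop_omega g s * max (z - s) 0
        \<le> trop_omega g s * ((1 - t) * max (x - s) 0 + t * max (y - s) 0)"
      using trop_omega_nonneg[OF g] hinge by (rule mult_left_mono[rotated])
    then show "trop_omega g s * max (z - s) 0
        \<le> (1 - t) * (trop_omega g s * max (x - s) 0) + t * (trop_omega g s * max (y - s) 0)"
      by (simp add: algebra_simps)
  qed
  also have "\<dots> = (1 - t) * (\<Sum>s\<in>?K. trop_omega g s * max (x - s) 0)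
      + t * (\<Sum>s\<in>?K. trop_omega g s * max (y - s) 0)"
    by (simp add: sum.distrib sum_distrib_left)
  finally have "g z \<le> (1 - t) * g x + t * g y"
    unfolding rep[OF z] rep[OF xy(1)] rep[OF xy(2)] by (simp add: z_def algebra_simps)
  then show "g ((1 - t) *\<^sub>R x + t *\<^sub>R y) \<le> (1 - t) * g x + t * g y"
    by (simp add: z_def)
qed simp

text \<open>
  Both sides are linear in the hinges: a root \<open>s\<close> is counted by \<open>n(t)\<close> for \<open>t \<in> [\<bar>s\<bar>, r]\<close>, which
  contributes \<open>\<omega>(s) (r - \<bar>s\<bar>)\<close> to \<open>2 N(r)\<close>, and the second difference
  \<open>g(r) + g(- r) - 2 g(0)\<close> of its hinge is the same number; affine functions have second
  difference zero.
\<close>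

lemma jensen_formula:
  assumes g: "locally_convex_pl g" and r: "0 \<le> r"
  shows "trop_N r (\<lambda>x. - g x) = 1/2 * (g r + g (- r)) - g 0"
proof -
  let ?K = "{s. \<bar>s\<bar> \<le> r \<and> trop_omega g s \<noteq> 0}"
  let ?w = "trop_omega g"
  have fin: "finite ?K" using finite_nonzero_omega[OF g] .
  have n: "trop_n t (\<lambda>x. - g x) = (\<Sum>s\<in>?K. if t \<in> {\<bar>s\<bar>..r} then ?w s else 0)"
    if "t \<in> {0..r}" for t
  proof -
    have "{s. \<bar>s\<bar> \<le> t \<and> trop_pole (\<lambda>x. - g x) s} = {s \<in> ?K. t \<in> {\<bar>s\<bar>..r}}"
      using that trop_omega_nonneg[OF g] less_eq_real_def
      by (auto simp: trop_pole_def trop_omega_uminus[OF g])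
    then have "trop_n t (\<lambda>x. - g x) = (\<Sum>s\<in>{s \<in> ?K. t \<in> {\<bar>s\<bar>..r}}. ?w s)"
      using trop_omega_nonneg[OF g] by (simp add: trop_n_def trop_omega_uminus[OF g])
    also have "\<dots> = (\<Sum>s\<in>?K. if t \<in> {\<bar>s\<bar>..r} then ?w s else 0)"
      using fin by (rule sum.inter_filter)
    finally show ?thesis .
  qed
  have "((\<lambda>t. \<Sum>s\<in>?K. if t \<in> {\<bar>s\<bar>..r} then ?w s else 0) has_integral
      (\<Sum>s\<in>?K. ?w s * (r - \<bar>s\<bar>))) {0..r}"
  proof (intro has_integral_sum fin)
    fix s assume s: "s \<in> ?K"
    have "((\<lambda>t. ?w s) has_integral ?w s * (r - \<bar>s\<bar>)) {\<bar>s\<bar>..r}"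
      using has_integral_const_real[of "?w s" "\<bar>s\<bar>" r] s by (simp add: mult.commute)
    then show "((\<lambda>t. if t \<in> {\<bar>s\<bar>..r} then ?w s else 0) has_integral ?w s * (r - \<bar>s\<bar>)) {0..r}"
      by (subst has_integral_restrict) auto
  qed
  then have "((\<lambda>t. trop_n t (\<lambda>x. - g x)) has_integral (\<Sum>s\<in>?K. ?w s * (r - \<bar>s\<bar>))) {0..r}"
    by (rule has_integral_eq[rotated]) (simp add: n)
  then have N: "trop_N r (\<lambda>x. - g x) = 1/2 * (\<Sum>s\<in>?K. ?w s * (r - \<bar>s\<bar>))"
    by (simp add: trop_N_def integral_unique)
  obtain \<alpha> \<beta> where "\<forall>z\<in>{-r..r}. g z = \<alpha> + \<beta> * z +
      (\<Sum>s\<in>?K. ?w s * max (z - s) 0)"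
    using hinge_representation[OF g, of r] by blast
  then have rep: "\<And>z. z \<in> {-r..r} \<Longrightarrow> g z = \<alpha> + \<beta> * z +
      (\<Sum>s\<in>?K. ?w s * max (z - s) 0)" by blast
  have "g r + g (- r) - 2 * g 0 = (\<Sum>s\<in>?K. ?w s * max (r - s) 0)
      + (\<Sum>s\<in>?K. ?w s * max (- r - s) 0) - 2 * (\<Sum>s\<in>?K. ?w s * max (0 - s) 0)"
    using rep[of r] rep[of "- r"] rep[of 0] r by simp
  also have "\<dots> = (\<Sum>s\<in>?K. ?w s * max (r - s) 0 + ?w s * max (- r - s) 0 - 2 * (?w s * max (0 - s) 0))"
    by (simp only: sum.distrib sum_subtractf sum_distrib_left)
  also have "\<dots> = (\<Sum>s\<in>?K. ?w s * (r - \<bar>s\<bar>))"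
    by (rule sum.cong) (auto simp: max_def abs_if algebra_simps split: if_splits)
  finally show ?thesis unfolding N by (simp add: field_simps)
qed

section \<open>Growth of the characteristic\<close>

text \<open>
  If \<open>g a < g b\<close>, convexity forces \<open>g\<close> to grow at least linearly on the ray from \<open>a\<close> through \<open>b\<close>.
\<close>

lemma convex_bounded_above_imp_constant:
  fixes g :: "real \<Rightarrow> real"
  assumes g: "convex_on UNIV g" and bd: "\<And>x. g x \<le> B"
  shows "g a = g b"
proof -
  have "g b \<le> g a" for a b
  proof (rule ccontr)
    assume "\<not> g b \<le> g a"
    then have d: "0 < g b - g a" by simp
    \<comment> \<open>The chord from \<open>a\<close> to \<open>b\<close>, prolonged by the factor \<open>t\<close>, exceeds \<open>B\<close> by \<open>g b - g a\<close>.\<close>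
    define t where "t = (B - g a) / (g b - g a) + 1"
    have t: "1 \<le> t" using d bd[of a] by (simp add: t_def)
    define p where "p = a + t * (b - a)"
    have "g ((1 - 1/t) *\<^sub>R a + (1/t) *\<^sub>R p) \<le> (1 - 1/t) * g a + (1/t) * g p"
      using t by (intro convex_onD[OF g]) auto
    also have "(1 - 1/t) *\<^sub>R a + (1/t) *\<^sub>R p = b"
      using t by (simp add: p_def algebra_simps)
    finally have "g b \<le> (1 - 1/t) * g a + (1/t) * g p" .
    then have "t * g b \<le> t * ((1 - 1/t) * g a + (1/t) * g p)" using t by (intro mult_left_mono) auto
    also have "\<dots> = (t - 1) * g a + g p" using t by (simp add: algebra_simps)
    finally have "g a + t * (g b - g a) \<le> g p" by (simp add: algebra_simps)
    moreover have "t * (g b - g a) = B - g a + (g b - g a)" using d by (simp add: t_def field_simps)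
    ultimately show False using bd[of p] d by simp
  qed
  then show ?thesis by (metis antisym)
qed

lemma convex_reflect:
  fixes g :: "real \<Rightarrow> real"
  assumes "convex_on UNIV g" shows "convex_on UNIV (\<lambda>x. g (- x))"
proof (rule convex_onI)
  fix t x y :: real assume "0 < t" "t < 1"
  then have "g ((1 - t) *\<^sub>R (- x) + t *\<^sub>R (- y)) \<le> (1 - t) * g (- x) + t * g (- y)"
    by (intro convex_onD[OF assms]) auto
  then show "g (- ((1 - t) *\<^sub>R x + t *\<^sub>R y)) \<le> (1 - t) * g (- x) + t * g (- y)"
    by (simp add: algebra_simps)
qed simp

text \<open>
  The slopes of \<open>g\<close> on the right half-line are at least the slope of its chord over \<open>[-1, 0]\<close>.
\<close>

lemma convex_increment_ge:
  fixes g :: "real \<Rightarrow> real"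
  assumes g: "convex_on UNIV g" and xy: "0 \<le> x" "x \<le> y"
  shows "- \<bar>g 0 - g (-1)\<bar> * (y - x) \<le> g y - g x"
proof (cases "x = y")
  case False
  then have lt: "x < y" using xy by simp
  have "(g (-1) - g 0) / (-1 - 0) \<le> (g (-1) - g y) / (-1 - y)"
    "(g (-1) - g y) / (-1 - y) \<le> (g 0 - g y) / (0 - y)"
    using convex_on_slope_le[OF g, of "-1" y 0] xy lt by auto
  moreover have "(g 0 - g y) / (0 - y) \<le> (g x - g y) / (x - y)"
    using convex_on_slope_le(2)[OF g, of 0 y x] xy lt by (cases "x = 0") auto
  moreover have "(g x - g y) / (x - y) = (g y - g x) / (y - x)"
    using minus_divide_divide[of "g x - g y" "x - y"] by simp
  ultimately have "g 0 - g (-1) \<le> (g y - g x) / (y - x)" by simp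
  then have "- \<bar>g 0 - g (-1)\<bar> \<le> (g y - g x) / (y - x)" by simp
  then show ?thesis using lt by (simp add: pos_le_divide_eq)
qed simp

text \<open>
  With coefficients \<open>- b i\<close> all terms of the linear form coincide along the curve.
\<close>

lemma common_profile_imp_degenerate:
  assumes n: "n \<ge> 1" and profile: "\<And>i x. i \<le> n \<Longrightarrow> f i x = b i + \<phi> x"
  shows "\<not> trop_lin_nondegenerate n f"
proof -
  define a where "a = (\<lambda>i. ereal (- b i))"
  have "curve_point n f x \<in> trop_hyperplane n a" for x
  proof -
    let ?y = "\<lambda>i. ereal (f i x)"
    have y: "?y \<in> trop_nonzero_vectors n" by (auto simp: trop_nonzero_vectors_def)
    then have 1: "curve_point n f x \<in> trop_proj_space n"
      unfolding curve_point_def trop_point_def trop_proj_space_def by (rule quotientI)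
    have 2: "?y \<in> curve_point n f x"
      using y unfolding curve_point_def trop_point_def trop_proj_rel_def
      by (auto intro: exI[of _ 0])
    have 3: "max_attained_twice {..n} (\<lambda>i. a i + ?y i)"
    proof -
      have "(\<lambda>i. a i + ?y i) ` {..n} = {ereal (\<phi> x)}"
        using n by (auto simp: a_def profile image_iff)
      moreover have "a 0 + ?y 0 = ereal (\<phi> x)" "a 1 + ?y 1 = ereal (\<phi> x)"
        using n by (simp_all add: a_def profile)
      ultimately show ?thesis using n unfolding max_attained_twice_def
        by (intro bexI[of _ 0] bexI[of _ 1]) auto
    qed
    show ?thesis unfolding trop_hyperplane_def by (intro CollectI conjI 1 bexI[of _ ?y] 2 3)
  qed
  moreover have "a \<in> trop_nonzero_vectors n" by (auto simp: a_def trop_nonzero_vectors_def)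
  ultimately show ?thesis unfolding trop_lin_nondegenerate_def by blast
qed

text \<open>
  \<open>T\<^sub>f\<close> is half of the second difference of the convex function \<open>G = max\<^sub>i f\<^sub>i\<close>, so it is convex,
  vanishes at \<open>0\<close>, and grows linearly as soon as it is positive somewhere.  If it were nowhere
  positive, then \<open>f\<^sub>i(x) + G(- x) \<le> G(x) + G(- x) \<le> 2 G(0)\<close> would be a convex function bounded
  above, hence constant, so all \<open>f\<^sub>i\<close> would agree up to constants and the curve would be degenerate.
\<close>

lemma trop_T_linear_growth:
  assumes n: "n \<ge> 1" and f: "\<And>i. i \<le> n \<Longrightarrow> locally_convex_pl (f i)"
    and nondeg: "trop_lin_nondegenerate n f"
  obtains \<kappa> where "\<kappa> > 0" "\<forall>\<^sub>F r in at_top. \<kappa> * r \<le> trop_T n f r"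
proof -
  let ?G = "curve_norm n f"
  have G: "convex_on UNIV ?G"
    unfolding curve_norm_def
    by (intro locally_convex_pl_convex locally_convex_pl_Max) (auto intro: f)
  have "\<exists>r0>0. 0 < trop_T n f r0"
  proof (rule ccontr)
    assume "\<not> (\<exists>r0>0. 0 < trop_T n f r0)"
    then have pos: "?G r + ?G (- r) \<le> 2 * ?G 0" if "0 < r" for r
      using that by (force simp: trop_T_def)
    have sym: "?G r + ?G (- r) \<le> 2 * ?G 0" for r
      using pos[of r] pos[of "- r"] by (cases r "0::real" rule: linorder_cases) auto
    have "f i x + ?G (- x) = f i 0 + ?G (- 0)" if i: "i \<le> n" for i x
    proof (rule convex_bounded_above_imp_constant[of "\<lambda>x. f i x + ?G (- x)" "2 * ?G 0"])
      show "convex_on UNIV (\<lambda>x. f i x + ?G (- x))"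
        using locally_convex_pl_convex[OF f[OF i]] convex_reflect[OF G] by (rule convex_on_add)
      show "f i x + ?G (- x) \<le> 2 * ?G 0" for x
        using sym[of x] curve_norm_ge[OF i, of f x] by simp
    qed
    then have "f i x = f i 0 + (?G 0 - ?G (- x))" if "i \<le> n" for i x
      using that by (simp add: algebra_simps)
    then have "\<not> trop_lin_nondegenerate n f" by (rule common_profile_imp_degenerate[OF n])
    then show False using nondeg by contradiction
  qed
  then obtain r0 where r0: "0 < r0" "0 < trop_T n f r0" by blast
  have "trop_T n f r0 / r0 * r \<le> trop_T n f r" if r: "r0 \<le> r" for r
  proof -
    define t where "t = r0 / r"
    have t: "0 \<le> t" "t \<le> 1" "t * r = r0" using r r0 by (auto simp: t_def)
    have "?G ((1 - t) *\<^sub>R 0 + t *\<^sub>R r) \<le> (1 - t) * ?G 0 + t * ?G r"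
      "?G ((1 - t) *\<^sub>R 0 + t *\<^sub>R (- r)) \<le> (1 - t) * ?G 0 + t * ?G (- r)"
      using t by (intro convex_onD[OF G]; simp)+
    then have "trop_T n f r0 \<le> t * trop_T n f r"
      using t by (simp add: trop_T_def algebra_simps)
    then show ?thesis using r r0 by (simp add: t_def field_simps)
  qed
  then have "\<forall>\<^sub>F r in at_top. trop_T n f r0 / r0 * r \<le> trop_T n f r"
    by (rule eventually_at_top_linorderI)
  moreover have "0 < trop_T n f r0 / r0" using r0 by simp
  ultimately show ?thesis using that by blast
qed

section \<open>The exceptional set\<close>

text \<open>
  The function \<open>m(R) = sup {L(t + s) / t | t \<ge> R}\<close> decreases to zero.  The threshold \<open>\<delta> = \<surd>m\<close>
  balances two requirements: it tends to zero, so the increment of \<open>L\<close> tends to zero wherever it lies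
  below \<open>\<delta>\<close>, and on \<open>[1, R]\<close> the set \<open>E\<close> where the increment is at least \<open>\<delta>\<close> has measure at most
  \<open>s L(R + s) / \<delta>(R) \<le> s R m(R) / \<delta>(R) = s R \<delta>(R)\<close> by Markov's inequality.
\<close>

lemma slow_growth_shift:
  fixes L :: "real \<Rightarrow> real"
  assumes mono: "mono L" and cont: "continuous_on UNIV L" and ge1: "\<And>t. 1 \<le> L t"
    and slow: "((\<lambda>t. L t / t) \<longlongrightarrow> 0) at_top" and s: "0 < s"
  obtains E where "zero_upper_density E"
    "((\<lambda>r. L (r + s) - L r) \<longlongrightarrow> 0) (inf at_top (principal (- E)))"
proof -
  define g where "g = (\<lambda>t. L (t + s) / t)"
  have lim: "(g \<longlongrightarrow> 0) at_top"
  proof -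
    have "((\<lambda>t. L (t + s) / (t + s)) \<longlongrightarrow> 0) at_top"
      by (rule filterlim_compose[OF slow filterlim_at_top_mono[OF filterlim_ident]]) (use s in simp)
    moreover have "((\<lambda>t. 1 + s / t) \<longlongrightarrow> 1 + 0) at_top"
      by (intro tendsto_intros tendsto_divide_0[OF tendsto_const] filterlim_at_top_imp_at_infinity filterlim_ident)
    ultimately have "((\<lambda>t. L (t + s) / (t + s) * (1 + s / t)) \<longlongrightarrow> 0 * (1 + 0)) at_top"
      by (rule tendsto_mult)
    moreover have "\<forall>\<^sub>F t in at_top. L (t + s) / (t + s) * (1 + s / t) = g t"
      using eventually_gt_at_top[of 0]
    proof (rule eventually_mono)
      fix t :: real assume t: "0 < t"
      then have "1 + s / t = (t + s) / t" by (simp add: add_divide_distrib)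
      then show "L (t + s) / (t + s) * (1 + s / t) = g t" using t s by (simp add: g_def)
    qed
    ultimately show ?thesis by (simp add: tendsto_cong)
  qed
  define m where "m = (\<lambda>R. SUP t\<in>{R..}. g t)"
  have bdd: "bdd_above (g ` {R..})" if "1 \<le> R" for R
  proof -
    obtain t0 where t0: "\<And>t. t0 \<le> t \<Longrightarrow> g t < 1"
      using order_tendstoD(2)[OF lim, of 1] by (auto simp: eventually_at_top_linorder)
    have "g t \<le> max 1 (L (t0 + s))" if "1 \<le> t" for t
    proof (cases "t0 \<le> t")
      case True
      then show ?thesis using t0[of t] by simp
    next
      case False
      have "g t \<le> L (t + s)"
        unfolding g_def using that ge1[of "t + s"] by (simp add: divide_le_eq mult_le_cancel_left1)
      also have "\<dots> \<le> L (t0 + s)" using False by (intro monoD[OF mono]) simp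
      finally show ?thesis by simp
    qed
    then show ?thesis using that by (intro bdd_aboveI2[of _ _ "max 1 (L (t0 + s))"]) auto
  qed
  have g_le_m: "g t \<le> m R" if "1 \<le> R" "R \<le> t" for R t
    unfolding m_def using that by (intro cSUP_upper bdd) auto
  have m_pos: "0 < m R" if "1 \<le> R" for R
  proof -
    have "0 < g R" using that ge1[of "R + s"] by (simp add: g_def)
    then show ?thesis using g_le_m[OF that order_refl] by simp
  qed
  have m_antimono: "m R' \<le> m R" if "1 \<le> R" "R \<le> R'" for R R'
    unfolding m_def using that by (intro cSUP_subset_mono bdd) auto
  have m_lim: "(m \<longlongrightarrow> 0) at_top"
  proof (rule order_tendstoI)
    fix a :: real assume a: "a < 0"
    show "\<forall>\<^sub>F R in at_top. a < m R"
      using eventually_ge_at_top[of 1]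
      by (rule eventually_mono) (rule less_trans[OF a m_pos])
  next
    fix a :: real assume a: "0 < a"
    then obtain t0 where t0: "\<And>t. t0 \<le> t \<Longrightarrow> g t < a / 2"
      using order_tendstoD(2)[OF lim, of "a / 2"] by (auto simp: eventually_at_top_linorder)
    have "m R < a" if "max 1 t0 \<le> R" for R
    proof -
      have "m R \<le> a / 2"
        unfolding m_def using that by (intro cSUP_least less_imp_le[OF t0]) auto
      then show ?thesis using a by simp
    qed
    then show "\<forall>\<^sub>F R in at_top. m R < a"
      by (rule eventually_at_top_linorderI)
  qed
  define \<delta> where "\<delta> = (\<lambda>R. sqrt (m (max 1 R)))"
  have \<delta>_pos: "0 < \<delta> R" for R by (simp add: \<delta>_def m_pos)
  have \<delta>_antimono: "\<delta> R' \<le> \<delta> R" if "R \<le> R'" for R R'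
    unfolding \<delta>_def using that by (intro real_sqrt_le_mono m_antimono) auto
  have \<delta>_lim: "(\<delta> \<longlongrightarrow> 0) at_top"
  proof -
    have "((\<lambda>R. sqrt (m R)) \<longlongrightarrow> sqrt 0) at_top" by (intro tendsto_real_sqrt m_lim)
    moreover have "\<forall>\<^sub>F R in at_top. sqrt (m R) = \<delta> R"
      using eventually_ge_at_top[of 1] by (rule eventually_mono) (simp add: \<delta>_def max_def)
    ultimately show ?thesis by (simp add: tendsto_cong)
  qed
  define E where "E = {r. 1 \<le> r \<and> \<delta> r \<le> L (r + s) - L r}"
  have \<delta>_meas: "\<delta> \<in> borel_measurable borel"
  proof -
    have "(\<lambda>r. - \<delta> r) \<in> borel_measurable borel"
      by (rule borel_measurable_mono) (auto simp: mono_def \<delta>_antimono)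
    then show ?thesis using borel_measurable_uminus_eq by blast
  qed
  have L_meas: "L \<in> borel_measurable borel" by (rule borel_measurable_mono[OF mono])
  have E_sets: "E \<in> sets lebesgue"
  proof -
    have "{r \<in> space borel. 1 \<le> r \<and> \<delta> r \<le> L (r + s) - L r} \<in> sets borel"
      using \<delta>_meas L_meas by measurable
    then show ?thesis unfolding E_def by (auto intro: sets_completionI_sets)
  qed
  have density: "1 / R * measure lebesgue (E \<inter> {1..R}) \<le> s * \<delta> R" if R: "1 \<le> R" for R
  proof -
    let ?S = "E \<inter> {1..R}"
    have S: "?S \<in> lmeasurable"
    proof (rule fmeasurableI2)
      show "{1..R} \<in> lmeasurable" by (rule lmeasurable_interval)
      show "?S \<in> sets lebesgue" by (rule sets.Int[OF E_sets]) simp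
    qed simp
    have int: "L integrable_on {a..b}" for a b
      by (rule integrable_continuous_interval[OF continuous_on_subset[OF cont subset_UNIV]])
    have "((\<lambda>t. L (t + s)) has_integral integral {1+s..R+s} L) {1..R}"
      using has_integral_shift_real_ivl[OF integrable_integral[OF int, of "1+s" "R+s"], of s] by simp
    then have incr: "((\<lambda>t. L (t + s) - L t) has_integral integral {1+s..R+s} L - integral {1..R} L) {1..R}"
      by (intro has_integral_diff integrable_integral int)
    have "((\<lambda>t. if t \<in> ?S then \<delta> R else 0) has_integral measure lebesgue ?S * \<delta> R) {1..R}"
    proof (subst has_integral_restrict)
      show "((\<lambda>t. \<delta> R) has_integral measure lebesgue ?S * \<delta> R) ?S"
      proof -
        have "((\<lambda>t. 1) has_integral measure lebesgue ?S) ?S"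
          unfolding lmeasure_integral[OF S]
          by (rule integrable_integral[OF iffD1[OF lmeasurable_iff_integrable_on S]])
        from has_integral_mult_left[OF this, of "\<delta> R"] show ?thesis by simp
      qed
    qed auto
    then have "measure lebesgue ?S * \<delta> R \<le> integral {1+s..R+s} L - integral {1..R} L"
    proof (rule has_integral_le[OF _ incr])
      fix t assume t: "t \<in> {1..R}"
      show "(if t \<in> ?S then \<delta> R else 0) \<le> L (t + s) - L t"
        using t s \<delta>_antimono[of t R] monoD[OF mono, of t "t + s"] by (auto simp: E_def)
    qed
    also have "\<dots> = integral {R..R+s} L - integral {1..1+s} L"
      using R s Henstock_Kurzweil_Integration.integral_combine[OF _ _ int, of 1 "1 + s" "R + s"]
        Henstock_Kurzweil_Integration.integral_combine[OF _ _ int, of 1 R "R + s"] by simp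
    also have "\<dots> \<le> integral {R..R+s} L"
      using integral_nonneg[OF int, of 1 "1 + s"] order_trans[OF zero_le_one ge1] by simp
    also have "\<dots> \<le> integral {R..R+s} (\<lambda>t. L (R + s))"
      by (intro integral_le int integrable_const_ivl monoD[OF mono]) simp
    also have "\<dots> = s * L (R + s)" using s by simp
    also have "\<dots> = s * (R * g R)" using R by (simp add: g_def)
    also have "\<dots> \<le> s * (R * (\<delta> R * \<delta> R))"
      using g_le_m[OF R order_refl] R s m_pos[OF R]
      by (intro mult_left_mono) (auto simp: \<delta>_def max_def)
    finally have "measure lebesgue ?S * \<delta> R \<le> (s * R * \<delta> R) * \<delta> R" by (simp add: mult.assoc)
    then have "measure lebesgue ?S \<le> s * R * \<delta> R" using \<delta>_pos[of R] by simp
    then show ?thesis using R by (simp add: field_simps)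
  qed
  have "((\<lambda>R. 1 / R * measure lebesgue (E \<inter> {1..R})) \<longlongrightarrow> 0) at_top"
  proof (rule tendsto_sandwich[where f = "\<lambda>_. 0"])
    show "((\<lambda>R. s * \<delta> R) \<longlongrightarrow> 0) at_top" using tendsto_mult_right_zero[OF \<delta>_lim] .
    show "\<forall>\<^sub>F R in at_top. 1 / R * measure lebesgue (E \<inter> {1..R}) \<le> s * \<delta> R"
      using eventually_ge_at_top[of 1] by (rule eventually_mono) (rule density)
    show "\<forall>\<^sub>F R in at_top. 0 \<le> 1 / R * measure lebesgue (E \<inter> {1..R})"
      using eventually_ge_at_top[of "0::real"] by (rule eventually_mono) simp
  qed simp
  then have "zero_upper_density E"
    unfolding zero_upper_density_def using E_sets
    by (auto simp: E_def zero_ereal_def intro!: lim_imp_Limsup)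
  moreover have "((\<lambda>r. L (r + s) - L r) \<longlongrightarrow> 0) (inf at_top (principal (- E)))"
  proof (rule tendsto_sandwich[where f = "\<lambda>_. 0"])
    show "(\<delta> \<longlongrightarrow> 0) (inf at_top (principal (- E)))"
      by (rule tendsto_mono[OF inf_le1 \<delta>_lim])
    show "\<forall>\<^sub>F r in inf at_top (principal (- E)). L (r + s) - L r \<le> \<delta> r"
      unfolding eventually_inf_principal using eventually_ge_at_top[of 1]
      by (rule eventually_mono) (auto simp: E_def)
    show "\<forall>\<^sub>F r in inf at_top (principal (- E)). 0 \<le> L (r + s) - L r"
      using s by (intro always_eventually) (auto intro: monoD[OF mono])
  qed simp
  ultimately show ?thesis using that by blast
qed

text \<open>
  Eventually \<open>0 \<le> ln u / r \<le> ln M / r + ln T / r\<close>.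
\<close>

lemma log_majorant_slow:
  fixes T u :: "real \<Rightarrow> real"
  assumes slow: "Limsup at_top (\<lambda>r. ereal (ln (T r) / r)) = 0"
    and M: "0 < M" "\<forall>\<^sub>F r in at_top. u r \<le> M * T r"
    and u: "\<forall>\<^sub>F r in at_top. 1 \<le> u r"
  shows "((\<lambda>r. ln (u r) / r) \<longlongrightarrow> 0) at_top"
proof (rule order_tendstoI)
  fix e :: real assume e: "e < 0"
  show "\<forall>\<^sub>F r in at_top. e < ln (u r) / r"
    using u eventually_gt_at_top[of 0]
  proof eventually_elim
    case (elim r)
    then have "0 \<le> ln (u r) / r" by simp
    then show ?case using e by simp
  qed
next
  fix e :: real assume e: "0 < e"
  have "\<forall>\<^sub>F r in at_top. ereal (ln (T r) / r) < ereal (e / 2)"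
    using e by (intro Limsup_lessD) (simp add: slow)
  then have lnT: "\<forall>\<^sub>F r in at_top. ln (T r) / r < e / 2" by simp
  have "((\<lambda>r. ln M / r) \<longlongrightarrow> 0) at_top"
    by (intro tendsto_divide_0[OF tendsto_const] filterlim_at_top_imp_at_infinity filterlim_ident)
  then have lnM: "\<forall>\<^sub>F r in at_top. ln M / r < e / 2"
    using e by (intro order_tendstoD) auto
  show "\<forall>\<^sub>F r in at_top. ln (u r) / r < e"
    using lnT lnM u M(2) eventually_gt_at_top[of 0]
  proof eventually_elim
    case (elim r)
    have "0 < M * T r" using elim by linarith
    then have "0 < T r" using M(1) by (simp add: zero_less_mult_iff)
    have "ln (u r) \<le> ln (M * T r)" using elim by simp
    also have "\<dots> = ln M + ln (T r)" using M(1) \<open>0 < T r\<close> by (simp add: ln_mult)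
    finally have "ln (u r) / r \<le> (ln M + ln (T r)) / r" using elim by (intro divide_right_mono) auto
    then show ?case using elim(1,2) unfolding add_divide_distrib by linarith
  qed
qed

lemma smallo_increment:
  fixes u T :: "real \<Rightarrow> real"
  assumes lim: "((\<lambda>r. ln (u (r + s)) - ln (u r)) \<longlongrightarrow> 0) F"
    and pos: "\<forall>\<^sub>F r in F. 0 < u r \<and> 0 < u (r + s)" and uT: "u \<in> O[F](T)"
  shows "(\<lambda>r. u (r + s) - u r) \<in> o[F](T)"
proof -
  have "((\<lambda>r. exp (ln (u (r + s)) - ln (u r)) - 1) \<longlongrightarrow> exp 0 - 1) F"
    by (intro tendsto_intros lim)
  moreover have "\<forall>\<^sub>F r in F. exp (ln (u (r + s)) - ln (u r)) - 1 = (u (r + s) - u r) / u r"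
    using pos by (rule eventually_mono) (simp add: exp_diff diff_divide_distrib)
  ultimately have "((\<lambda>r. (u (r + s) - u r) / u r) \<longlongrightarrow> 0) F"
    by (simp add: tendsto_cong)
  moreover have "\<forall>\<^sub>F r in F. u r \<noteq> 0" using pos by (rule eventually_mono) simp
  ultimately have "(\<lambda>r. u (r + s) - u r) \<in> o[F](u)" by (rule smalloI_tendsto)
  then show ?thesis using uT by (rule landau_o.small_big_trans)
qed

section \<open>Shifts of the curve\<close>

text \<open>
  Each branch \<open>f\<^sub>i(\<sigma> r)\<close>, \<open>r \<ge> 0\<close>, becomes increasing after adding \<open>A r\<close>, where \<open>A\<close> bounds all chord slopes
  next to the origin.  The sum \<open>u\<close> of these increasing functions then bounds the increment of each
  of them; a shift towards the origin costs only the linear correction.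
  In the upper bound for \<open>u\<close>, the values \<open>f\<^sub>i(r) + f\<^sub>i(- r)\<close> are at most
  \<open>G(r) + G(- r) = 2 T\<^sub>f(r) + 2 G(0)\<close>.  The summand \<open>exp 1\<close> keeps \<open>ln u\<close> above \<open>1\<close>.
\<close>

lemma shift_majorant:
  assumes f: "\<And>i. i \<le> n \<Longrightarrow> locally_convex_pl (f i)"
  obtains u A D where "continuous_on UNIV u" "mono_on {0..} u" "\<And>r. 0 \<le> r \<Longrightarrow> exp 1 \<le> u r"
    "0 \<le> A"
    "\<And>i \<sigma> r s t. i \<le> n \<Longrightarrow> \<sigma> \<in> {1, -1} \<Longrightarrow> 0 \<le> s \<Longrightarrow> s \<le> r \<Longrightarrow> \<bar>t\<bar> \<le> s \<Longrightarrow>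
      f i (\<sigma> * r + t) \<le> f i (\<sigma> * r) + (u (r + s) - u r) + A * s"
    "0 \<le> D" "\<And>r. 0 \<le> r \<Longrightarrow> u r \<le> D * (1 + r) + 2 * (real n + 1) * trop_T n f r"
proof -
  define A where "A = (\<Sum>i\<le>n. \<bar>f i 0 - f i (- 1)\<bar> + \<bar>f i 0 - f i 1\<bar>)"
  define v where "v = (\<lambda>i \<sigma> r. f i (\<sigma> * r) - f i 0 + A * r)"
  define u where "u = (\<lambda>r. exp 1 + (\<Sum>i\<le>n. v i 1 r + v i (- 1) r))"
  have A_ge: "\<bar>f i 0 - f i (- \<sigma>)\<bar> \<le> A" if "i \<le> n" "\<sigma> \<in> {1, -1}" for i \<sigma>
  proof -
    have "\<bar>f i 0 - f i (- \<sigma>)\<bar> \<le> \<bar>f i 0 - f i (- 1)\<bar> + \<bar>f i 0 - f i 1\<bar>" using that(2) by auto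
    also have "\<dots> \<le> A" unfolding A_def
      by (rule member_le_sum[of i "{..n}"]) (use that(1) in auto)
    finally show ?thesis .
  qed
  have A0: "0 \<le> A" unfolding A_def by (intro sum_nonneg) auto
  have v_mono: "v i \<sigma> x \<le> v i \<sigma> y" if "i \<le> n" "\<sigma> \<in> {1, -1}" "0 \<le> x" "x \<le> y" for i \<sigma> x y
  proof -
    have "convex_on UNIV (\<lambda>x. f i (\<sigma> * x))"
      using that(2) locally_convex_pl_convex[OF f[OF that(1)]] convex_reflect by auto
    from convex_increment_ge[OF this that(3,4)]
    have "- \<bar>f i 0 - f i (- \<sigma>)\<bar> * (y - x) \<le> f i (\<sigma> * y) - f i (\<sigma> * x)" by simp
    moreover have "\<bar>f i 0 - f i (- \<sigma>)\<bar> * (y - x) \<le> A * (y - x)"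
      using A_ge[OF that(1,2)] that(4) by (intro mult_right_mono) auto
    ultimately show ?thesis by (simp add: v_def algebra_simps)
  qed
  have v_nonneg: "0 \<le> v i \<sigma> x" if "i \<le> n" "\<sigma> \<in> {1, -1}" "0 \<le> x" for i \<sigma> x
    using v_mono[OF that(1,2) order_refl that(3)] by (simp add: v_def)
  have u_diff: "u y - u x = (\<Sum>i\<le>n. (v i 1 y - v i 1 x) + (v i (- 1) y - v i (- 1) x))" for x y
    by (simp add: u_def sum.distrib sum_subtractf)
  have v_le_u: "v i \<sigma> y - v i \<sigma> x \<le> u y - u x" if "i \<le> n" "\<sigma> \<in> {1, -1}" "0 \<le> x" "x \<le> y" for i \<sigma> x y
  proof -
    have "v i \<sigma> y - v i \<sigma> x \<le> (v i 1 y - v i 1 x) + (v i (- 1) y - v i (- 1) x)"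
      using that(2) v_mono[OF that(1) _ that(3,4)] by auto
    also have "\<dots> \<le> u y - u x"
      unfolding u_diff
      by (rule member_le_sum[of i "{..n}"]) (use that v_mono[OF _ _ that(3,4)] in auto)
    finally show ?thesis .
  qed
  have cont: "continuous_on UNIV (f i)" if "i \<le> n" for i
    using convex_on_continuous[OF open_UNIV locally_convex_pl_convex[OF f[OF that]]] .
  have u_cont: "continuous_on UNIV u"
    unfolding u_def v_def
    by (intro continuous_intros continuous_on_compose2[OF cont]) auto
  have u_mono: "mono_on {0..} u"
    using v_le_u[of 0 1] v_mono[of 0 1] by (intro mono_onI) force
  have u_ge: "exp 1 \<le> u r" if "0 \<le> r" for r
    unfolding u_def using that by (auto intro!: sum_nonneg add_nonneg_nonneg v_nonneg)
  have shift: "f i (\<sigma> * r + t) \<le> f i (\<sigma> * r) + (u (r + s) - u r) + A * s"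
    if "i \<le> n" "\<sigma> \<in> {1, -1}" "0 \<le> s" "s \<le> r" "\<bar>t\<bar> \<le> s" for i \<sigma> r s t
  proof -
    have t: "\<sigma> * r + t = \<sigma> * (r + \<sigma> * t)" "0 \<le> r + \<sigma> * t" "r + \<sigma> * t \<le> r + s" "- s \<le> \<sigma> * t"
      using that by (auto simp: algebra_simps)
    have "f i (\<sigma> * r + t) = f i (\<sigma> * r) + (v i \<sigma> (r + \<sigma> * t) - v i \<sigma> r) - A * (\<sigma> * t)"
      unfolding t(1) by (simp add: v_def algebra_simps)
    moreover have "v i \<sigma> (r + \<sigma> * t) \<le> v i \<sigma> (r + s)"
      using t that by (intro v_mono) auto
    moreover have "v i \<sigma> (r + s) - v i \<sigma> r \<le> u (r + s) - u r"
      using that by (intro v_le_u) auto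
    moreover have "- (A * (\<sigma> * t)) \<le> A * s"
      using mult_left_mono[OF t(4) A0] by simp
    ultimately show ?thesis by linarith
  qed
  define B where "B = \<bar>curve_norm n f 0\<bar> + (\<Sum>i\<le>n. \<bar>f i 0\<bar>) + A"
  have B: "A \<le> B" "0 \<le> B" using A0 by (auto simp: B_def intro!: sum_nonneg add_nonneg_nonneg)
  have u_le: "u r \<le> (exp 1 + 2 * (real n + 1) * B) * (1 + r) + 2 * (real n + 1) * trop_T n f r"
    if r: "0 \<le> r" for r
  proof -
    have "v i 1 r + v i (- 1) r \<le> 2 * trop_T n f r + 2 * B * (1 + r)" if i: "i \<le> n" for i
    proof -
      have "\<bar>f i 0\<bar> \<le> (\<Sum>i\<le>n. \<bar>f i 0\<bar>)" by (rule member_le_sum[of i "{..n}"]) (use i in auto)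
      then have "curve_norm n f 0 - f i 0 \<le> B" using A0 by (simp add: B_def)
      moreover have "A * r \<le> B * r" using B r by (intro mult_right_mono)
      ultimately show ?thesis
        using curve_norm_ge[OF i, of f r] curve_norm_ge[OF i, of f "- r"]
        by (simp add: v_def trop_T_def algebra_simps)
    qed
    then have "(\<Sum>i\<le>n. v i 1 r + v i (- 1) r) \<le> (\<Sum>i\<le>n. 2 * trop_T n f r + 2 * B * (1 + r))"
      by (intro sum_mono) auto
    also have "\<dots> = 2 * (real n + 1) * B * (1 + r) + 2 * (real n + 1) * trop_T n f r"
      by (simp add: algebra_simps)
    moreover have "exp 1 * 1 \<le> exp 1 * (1 + r)" using r by (intro mult_left_mono) auto
    ultimately show ?thesis by (simp add: u_def algebra_simps)
  qed
  have D: "0 \<le> exp 1 + 2 * (real n + 1) * B" using B by (auto intro!: add_nonneg_nonneg)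
  show ?thesis by (rule that[OF u_cont u_mono u_ge A0 shift D u_le])
qed

lemma casorati_le:
  assumes shift: "\<And>i t. i \<le> n \<Longrightarrow> \<bar>t\<bar> \<le> real n * \<bar>c\<bar> \<Longrightarrow> f i (x + t) \<le> f i x + d"
  shows "trop_casorati n c f x \<le> (\<Sum>i\<le>n. f i x) + (real n + 1) * d"
  unfolding trop_casorati_def
proof (rule Max.boundedI)
  show "finite ((\<lambda>\<pi>. \<Sum>i\<le>n. f i (x + real (\<pi> i) * c)) ` {\<pi>. \<pi> permutes {..n}})"
    by (simp add: finite_permutations)
  show "(\<lambda>\<pi>. \<Sum>i\<le>n. f i (x + real (\<pi> i) * c)) ` {\<pi>. \<pi> permutes {..n}} \<noteq> {}"
    using permutes_id by blast
  fix y assume "y \<in> (\<lambda>\<pi>. \<Sum>i\<le>n. f i (x + real (\<pi> i) * c)) ` {\<pi>. \<pi> permutes {..n}}"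
  then obtain \<pi> where \<pi>: "\<pi> permutes {..n}" and y: "y = (\<Sum>i\<le>n. f i (x + real (\<pi> i) * c))"
    by blast
  have "y \<le> (\<Sum>i\<le>n. f i x + d)"
    unfolding y
  proof (rule sum_mono)
    fix i assume i: "i \<in> {..n}"
    then have "\<pi> i \<le> n" using permutes_in_image[OF \<pi>] by auto
    then have "\<bar>real (\<pi> i) * c\<bar> \<le> real n * \<bar>c\<bar>"
      by (simp add: abs_mult mult_right_mono)
    then show "f i (x + real (\<pi> i) * c) \<le> f i x + d" using shift i by simp
  qed
  also have "\<dots> = (\<Sum>i\<le>n. f i x) + (real n + 1) * d"
    by (simp add: sum.distrib algebra_simps)
  finally show "y \<le> (\<Sum>i\<le>n. f i x) + (real n + 1) * d" .
qed

section \<open>The second main theorem\<close>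

theorem theorem4p4:
  fixes n q :: nat and c :: real
    and f :: "nat \<Rightarrow> real \<Rightarrow> real"
    and a :: "nat \<Rightarrow> nat \<Rightarrow> ereal"
  assumes "n \<ge> 1" and "q \<ge> 1" and "c \<noteq> 0"
    and "trop_holomorphic_curve n f"
    and "trop_lin_nondegenerate n f"
    and "\<And>k. k \<in> {1..q} \<Longrightarrow> a k \<in> trop_nonzero_vectors n"
    and "Limsup at_top (\<lambda>r. ereal (ln (trop_T n f r) / r)) = 0"
  shows "\<exists>E. zero_upper_density E \<and>
          (\<exists>h \<in> o[inf at_top (principal (- E))](trop_T n f).
             \<forall>\<^sub>F r in inf at_top (principal (- E)).
               (\<Sum>\<sigma>\<in>{1, -1}. MAX K\<in>{K. K \<subseteq> {1..q} \<and> trop_lin_independent n K a}.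
                    1/2 * (\<Sum>k\<in>K. weil_function n (a k) f (\<sigma> * r)))
               \<le> (real n + 1) * trop_T n f r
                  - trop_N r (\<lambda>x. - trop_casorati n c f x) + h r)"
proof -
  let ?T = "trop_T n f" and ?G = "curve_norm n f" and ?C = "trop_casorati n c f"
  have f: "locally_convex_pl (f i)" if "i \<le> n" for i
    using assms(4) that by (simp add: trop_holomorphic_curve_def trop_entire_locally_convex_pl)
  have C: "locally_convex_pl ?C" by (rule locally_convex_pl_casorati) (rule f)
  \<comment> \<open>The largest shift in the Casorati determinant.\<close>
  define s where "s = real n * \<bar>c\<bar>"
  have s: "0 < s" using assms(1,3) by (simp add: s_def)
  obtain \<kappa> where \<kappa>: "\<kappa> > 0" "\<forall>\<^sub>F r in at_top. \<kappa> * r \<le> ?T r"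
    using trop_T_linear_growth[OF assms(1) f assms(5)] .
  obtain u A D where u_cont: "continuous_on UNIV u" and u_mono: "mono_on {0..} u"
    and u_ge: "\<And>r. 0 \<le> r \<Longrightarrow> exp 1 \<le> u r" and A: "0 \<le> A"
    and shift: "\<And>i \<sigma> r s t. i \<le> n \<Longrightarrow> \<sigma> \<in> {1, -1} \<Longrightarrow> 0 \<le> s \<Longrightarrow> s \<le> r \<Longrightarrow> \<bar>t\<bar> \<le> s \<Longrightarrow>
      f i (\<sigma> * r + t) \<le> f i (\<sigma> * r) + (u (r + s) - u r) + A * s"
    and D: "0 \<le> D" and u_le: "\<And>r. 0 \<le> r \<Longrightarrow> u r \<le> D * (1 + r) + 2 * (real n + 1) * ?T r"
    by (rule shift_majorant[OF f]) (assumption | rule that)+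
  \<comment> \<open>For \<open>r \<ge> 1\<close> the linear term \<open>D (1 + r)\<close> is at most \<open>2 D r \<le> (2 D / \<kappa>) T(r)\<close>.\<close>
  define M where "M = 2 * D / \<kappa> + 2 * (real n + 1)"
  have M: "0 < M" using D \<kappa>(1) by (auto simp: M_def intro!: add_nonneg_pos)
  have u_pos: "0 < u r" if "0 \<le> r" for r
    using u_ge[OF that] by (rule less_le_trans[OF exp_gt_zero])
  have uT: "\<forall>\<^sub>F r in at_top. u r \<le> M * ?T r"
    using \<kappa>(2) eventually_ge_at_top[of 1]
  proof eventually_elim
    case (elim r)
    have "r \<le> ?T r / \<kappa>" using elim(1) \<kappa>(1) by (simp add: pos_le_divide_eq mult.commute)
    then have "D * (1 + r) \<le> D * (2 * (?T r / \<kappa>))"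
      using elim(2) D by (intro mult_left_mono) auto
    then show ?case using u_le[of r] elim by (simp add: M_def algebra_simps)
  qed
  have T_top: "filterlim ?T at_top at_top"
    by (rule filterlim_at_top_mono[OF _ \<kappa>(2)])
      (rule filterlim_tendsto_pos_mult_at_top[OF tendsto_const \<kappa>(1) filterlim_ident])
  \<comment> \<open>The majorant is monotone only for \<open>r \<ge> 0\<close>, hence the truncation.\<close>
  define L where "L = (\<lambda>r. ln (u (max 0 r)))"
  have "((\<lambda>r. ln (u r) / r) \<longlongrightarrow> 0) at_top"
  proof (rule log_majorant_slow[OF assms(7) M uT])
    show "\<forall>\<^sub>F r in at_top. 1 \<le> u r"
      using eventually_ge_at_top[of "0::real"]
      by (rule eventually_mono) (rule order_trans[OF _ u_ge], simp_all)
  qed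
  moreover have "\<forall>\<^sub>F r in at_top. ln (u r) / r = L r / r"
    using eventually_ge_at_top[of "0::real"] by (rule eventually_mono) (simp add: L_def max_def)
  ultimately have L_slow: "((\<lambda>r. L r / r) \<longlongrightarrow> 0) at_top" by (simp add: tendsto_cong)
  have L_mono: "mono L"
  proof (rule monoI)
    fix x y :: real assume "x \<le> y"
    then have "u (max 0 x) \<le> u (max 0 y)" by (intro mono_onD[OF u_mono]) auto
    then show "L x \<le> L y"
      unfolding L_def using u_pos[of "max 0 x"] u_pos[of "max 0 y"] by simp
  qed
  have L_cont: "continuous_on UNIV L"
  proof -
    have "u (max 0 r) \<noteq> 0" for r using u_pos[of "max 0 r"] by simp
    then show ?thesis
      unfolding L_def by (intro continuous_intros continuous_on_compose2[OF u_cont]) auto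
  qed
  have L_ge: "1 \<le> L r" for r
    unfolding L_def using u_ge[of "max 0 r"] u_pos[of "max 0 r"] by (simp add: ln_ge_iff)
  obtain E where E: "zero_upper_density E"
    and L_lim: "((\<lambda>r. L (r + s) - L r) \<longlongrightarrow> 0) (inf at_top (principal (- E)))"
    using slow_growth_shift[OF L_mono L_cont L_ge L_slow s] .
  let ?F = "inf at_top (principal (- E))"
  have F: "eventually P ?F" if "eventually P at_top" for P
    using filter_leD[OF inf_le1 that] .
  have incr: "(\<lambda>r. u (r + s) - u r) \<in> o[?F](?T)"
  proof (rule smallo_increment)
    have "\<forall>\<^sub>F r in ?F. L (r + s) - L r = ln (u (r + s)) - ln (u r)"
      using F[OF eventually_ge_at_top[of 0]] by (rule eventually_mono) (use s in \<open>simp add: L_def\<close>)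
    then show "((\<lambda>r. ln (u (r + s)) - ln (u r)) \<longlongrightarrow> 0) ?F"
      using L_lim by (simp add: tendsto_cong)
    show "\<forall>\<^sub>F r in ?F. 0 < u r \<and> 0 < u (r + s)"
      using F[OF eventually_ge_at_top[of 0]] by (rule eventually_mono) (use s u_pos in simp)
    show "u \<in> O[?F](?T)"
    proof (rule bigoI)
      show "\<forall>\<^sub>F r in ?F. norm (u r) \<le> M * norm (?T r)"
        using F[OF uT] F[OF eventually_ge_at_top[of 0]]
      proof eventually_elim
        case (elim r)
        have "M * ?T r \<le> M * norm (?T r)" using M by (intro mult_left_mono) auto
        then show ?case using elim u_pos[of r] by simp
      qed
    qed
  qed
  define B where "B = (\<Sum>k\<in>{1..q}. \<Sum>i\<le>n. \<bar>real_of_ereal (coeff_norm n (a k)) - real_of_ereal (a k i)\<bar>)"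
  \<comment> \<open>Besides \<open>B\<close> and the cost of the shifts, \<open>b\<close> collects the values at \<open>0\<close> subtracted in \<open>T\<close> and \<open>N\<close>.\<close>
  define b where "b = B + (real n + 1) * (?G 0 + A * s) - ?C 0"
  define h where "h = (\<lambda>r. (real n + 1) * (u (r + s) - u r) + b)"
  have "(\<lambda>r. b) \<in> o[?F](?T)"
  proof (rule landau_o.small.filter_mono[OF inf_le1], rule smalloI_tendsto)
    show "((\<lambda>r. b / ?T r) \<longlongrightarrow> 0) at_top"
      by (rule tendsto_divide_0[OF tendsto_const filterlim_at_top_imp_at_infinity[OF T_top]])
    show "\<forall>\<^sub>F r in at_top. ?T r \<noteq> 0"
      using filterlim_at_top_dense[THEN iffD1, OF T_top, rule_format, of 0]
      by (rule eventually_mono) simp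
  qed
  then have h: "h \<in> o[?F](?T)"
    unfolding h_def using incr by (intro sum_in_smallo) simp_all
  have "(\<Sum>\<sigma>\<in>{1, -1}. MAX K\<in>{K. K \<subseteq> {1..q} \<and> trop_lin_independent n K a}.
          1/2 * (\<Sum>k\<in>K. weil_function n (a k) f (\<sigma> * r)))
        \<le> (real n + 1) * ?T r - trop_N r (\<lambda>x. - ?C x) + h r" if r: "s \<le> r" for r
  proof -
    let ?d = "u (r + s) - u r + A * s"
    have side: "(MAX K\<in>{K. K \<subseteq> {1..q} \<and> trop_lin_independent n K a}.
          1/2 * (\<Sum>k\<in>K. weil_function n (a k) f (\<sigma> * r)))
        \<le> 1/2 * (B + (real n + 1) * ?G (\<sigma> * r) - ?C (\<sigma> * r) + (real n + 1) * ?d)"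
      if \<sigma>: "\<sigma> \<in> {1, -1}" for \<sigma>
    proof -
      have weil: "(MAX K\<in>{K. K \<subseteq> {1..q} \<and> trop_lin_independent n K a}.
            1/2 * (\<Sum>k\<in>K. weil_function n (a k) f (\<sigma> * r)))
          \<le> 1/2 * (B + (\<Sum>i\<le>n. ?G (\<sigma> * r) - f i (\<sigma> * r)))"
        unfolding B_def by (rule max_weil_sum_le) (rule assms(6))
      have "?C (\<sigma> * r) \<le> (\<Sum>i\<le>n. f i (\<sigma> * r)) + (real n + 1) * ?d"
        by (rule casorati_le) (use shift[OF _ \<sigma> _ r] s in \<open>auto simp: s_def add.assoc\<close>)
      moreover have "(\<Sum>i\<le>n. ?G (\<sigma> * r) - f i (\<sigma> * r))
          = (real n + 1) * ?G (\<sigma> * r) - (\<Sum>i\<le>n. f i (\<sigma> * r))"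
        by (simp add: sum_subtractf algebra_simps)
      ultimately have "1/2 * (B + (\<Sum>i\<le>n. ?G (\<sigma> * r) - f i (\<sigma> * r)))
          \<le> 1/2 * (B + (real n + 1) * ?G (\<sigma> * r) - ?C (\<sigma> * r) + (real n + 1) * ?d)"
        by (intro mult_left_mono) simp_all
      then show ?thesis by (rule order_trans[OF weil])
    qed
    have N: "trop_N r (\<lambda>x. - ?C x) = 1/2 * (?C r + ?C (- r)) - ?C 0"
      using jensen_formula[OF C] r s by simp
    have "(\<Sum>\<sigma>\<in>{1, -1}. MAX K\<in>{K. K \<subseteq> {1..q} \<and> trop_lin_independent n K a}.
          1/2 * (\<Sum>k\<in>K. weil_function n (a k) f (\<sigma> * r)))
        \<le> (\<Sum>\<sigma>\<in>{1, -1::real}. 1/2 * (B + (real n + 1) * ?G (\<sigma> * r) - ?C (\<sigma> * r) + (real n + 1) * ?d))"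
      by (rule sum_mono) (rule side)
    also have "\<dots> = (real n + 1) * ?T r - trop_N r (\<lambda>x. - ?C x) + h r"
      unfolding N by (simp add: trop_T_def h_def b_def field_simps)
    finally show ?thesis .
  qed
  then have "\<forall>\<^sub>F r in ?F. (\<Sum>\<sigma>\<in>{1, -1}. MAX K\<in>{K. K \<subseteq> {1..q} \<and> trop_lin_independent n K a}.
          1/2 * (\<Sum>k\<in>K. weil_function n (a k) f (\<sigma> * r)))
        \<le> (real n + 1) * ?T r - trop_N r (\<lambda>x. - ?C x) + h r"
    by (intro F eventually_at_top_linorderI)
  then show ?thesis using E h by blast
qed

end
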